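(* Let $F$ be a field of characteristic $0$, let $n$ be a positive integer, let $f\in F\langle \mathcal X\rangle$ be a polynomial which is neither an identity nor a central polynomial of $M_n(F)$, and let $C$ be a commutative unital $F$-algebra. Then every commutator in $A=M_n(C)$ is a sum of $7788$ elements from $f(A)-f(A)$.
   Context: $F\langle \mathcal X\rangle$ is the free (unital, associative) algebra over $F$ on $\mathcal X=\{X_1,X_2,\dots\}$, i.e. the algebra of noncommutative polynomials. For $f=f(X_1,\dots,X_m)$ and a unital $F$-algebra $R$, $f(R)=\{f(a_1,\dots,a_m)\mid a_1,\dots,a_m\in R\}$ and $f(R)-f(R)=\{t-t'\mid t,t'\in f(R)\}$. $f$ is an identity of $R$ if $f(R)=\{0\}$; $f$ is a central polynomial of $R$ if $f(R)$ is contained in the center of $R$ but $f$ is not an identity of $R$ (a nonzero constant term is allowed). A commutator in $A$ is an element of the form $[x,y]=xy-yx$ with $x,y\in A$. *)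

theory Defs
  imports "HOL-Algebra.Module" "HOL-Library.Poly_Mapping" "Jordan_Normal_Form.Matrix"
begin

text \<open>The free monoid on letters indexed by natural numbers. Concatenation is written additively
  because the product of \<^type>\<open>poly_mapping\<close> adds exponents; with this instance
  \<open>word \<Rightarrow>\<^sub>0 'f\<close> with its library ring structure is the free unital algebra over
  \<open>'f\<close> on countably many generators, \<open>Word [i]\<close> being the generator with index \<open>i\<close>.\<close>

datatype word = Word (letters: "nat list")

instantiation word :: monoid_add
begin
definition zero_word :: word where "zero_word = Word []"
definition plus_word :: "word \<Rightarrow> word \<Rightarrow> word" where "u + v = Word (letters u @ letters v)"
instance by standard (simp_all add: zero_word_def plus_word_def)
end

type_synonym 'f ncpoly = "word \<Rightarrow>\<^sub>0 'f"

definition word_eval :: "('r, 'm) monoid_scheme \<Rightarrow> (nat \<Rightarrow> 'r) \<Rightarrow> word \<Rightarrow> 'r" where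
  "word_eval R a w = foldr (\<lambda>i x. a i \<otimes>\<^bsub>R\<^esub> x) (letters w) \<one>\<^bsub>R\<^esub>"

definition nc_eval :: "('f::zero, 'r, 'm) module_scheme \<Rightarrow> (nat \<Rightarrow> 'r) \<Rightarrow> 'f ncpoly \<Rightarrow> 'r" where
  "nc_eval R a f =
     (\<Oplus>\<^bsub>R\<^esub>w\<in>Poly_Mapping.keys f. Poly_Mapping.lookup f w \<odot>\<^bsub>R\<^esub> word_eval R a w)"

text \<open>All letters receive a value; those not occurring in \<open>f\<close> are irrelevant, so this is
  the image of \<open>f(X\<^sub>1, \<dots>, X\<^sub>m)\<close> for any sufficiently large \<open>m\<close>.\<close>

definition nc_image :: "('f::zero, 'r, 'm) module_scheme \<Rightarrow> 'f ncpoly \<Rightarrow> 'r set" where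
  "nc_image R f = {nc_eval R a f | a. a \<in> UNIV \<rightarrow> carrier R}"

definition nc_image_diff :: "('f::zero, 'r, 'm) module_scheme \<Rightarrow> 'f ncpoly \<Rightarrow> 'r set" where
  "nc_image_diff R f = {t \<ominus>\<^bsub>R\<^esub> t' | t t'. t \<in> nc_image R f \<and> t' \<in> nc_image R f}"

definition ring_center :: "('r, 'm) ring_scheme \<Rightarrow> 'r set" where
  "ring_center R = {z \<in> carrier R. \<forall>x\<in>carrier R. z \<otimes>\<^bsub>R\<^esub> x = x \<otimes>\<^bsub>R\<^esub> z}"

definition nc_identity :: "('f::zero, 'r, 'm) module_scheme \<Rightarrow> 'f ncpoly \<Rightarrow> bool" where
  "nc_identity R f \<longleftrightarrow> nc_image R f = {\<zero>\<^bsub>R\<^esub>}"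

definition nc_central :: "('f::zero, 'r, 'm) module_scheme \<Rightarrow> 'f ncpoly \<Rightarrow> bool" where
  "nc_central R f \<longleftrightarrow> nc_image R f \<subseteq> ring_center R \<and> \<not> nc_identity R f"

definition commutators :: "('r, 'm) ring_scheme \<Rightarrow> 'r set" where
  "commutators R =
     {x \<otimes>\<^bsub>R\<^esub> y \<ominus>\<^bsub>R\<^esub> y \<otimes>\<^bsub>R\<^esub> x | x y. x \<in> carrier R \<and> y \<in> carrier R}"

text \<open>The sort \<open>{comm_ring, monoid_mult}\<close> is that of commutative unital rings in which
  \<open>0 = 1\<close> is allowed, so that the zero algebra is included.\<close>

locale comm_unital_algebra = vector_space scale
  for scale :: "'f::field \<Rightarrow> 'c::{comm_ring,monoid_mult} \<Rightarrow> 'c" +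
  assumes scale_mult_left: "scale r (x * y) = scale r x * y"

lemma comm_unital_algebra_field: "comm_unital_algebra ((*) :: 'f::field \<Rightarrow> 'f \<Rightarrow> 'f)"
  by unfold_locales (simp_all add: algebra_simps)

text \<open>The algebra of square matrices over a commutative algebra with scalar multiplication
  \<open>scale\<close>. The library's \<^const>\<open>ring_mat\<close> is not used, since its sort
  \<^class>\<open>semiring_1\<close> excludes the zero algebra.\<close>

definition mat_algebra ::
  "('f \<Rightarrow> 'c::{comm_ring,monoid_mult} \<Rightarrow> 'c) \<Rightarrow> nat \<Rightarrow> ('f, 'c mat) module" where
  "mat_algebra scale n = \<lparr>
     carrier = carrier_mat n n,
     mult = (*),
     one = 1\<^sub>m n,
     zero = 0\<^sub>m n n,
     add = (+),
     smult = (\<lambda>r. map_mat (scale r))\<rparr>"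

lemma ring_mat_algebra: "ring (mat_algebra scale n)"
proof -
  have one_left: "1\<^sub>m n * A = A" and one_right: "A * 1\<^sub>m n = A"
    if "A \<in> carrier_mat n n" for A :: "'c::{comm_ring,monoid_mult} mat"
    using that by (auto intro!: eq_matI simp: scalar_prod_def if_distrib[of "\<lambda>x. x * _"]
        if_distrib[of "\<lambda>x. _ * x"] cong: if_cong)
  show ?thesis
    by unfold_locales
      (insert add_inv_exists_mat, auto simp: mat_algebra_def algebra_simps Units_def one_left one_right)
qed

end

theory Submission
  imports Defs "Jordan_Normal_Form.Determinant" "HOL-Algebra.RingHom"
begin

text \<open>The set \<open>f(A)\<close> is closed under conjugation, so if \<open>b \<in> f(A)\<close> and \<open>m\<^sup>2 = 0\<close>, then
  \<open>(1 + m) b (1 - m) - (1 - m) b (1 + m) = 2[m, b]\<close> lies in \<open>f(A) - f(A)\<close>. Modulo scalars, every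
  matrix over \<open>C\<close> is a sum of \<open>10\<close> matrices of square zero: a trace-zero upper triangular matrix
  plus the subdiagonal shift is conjugate to a companion matrix of trace zero. Hence each \<open>[x, b]\<close>
  is a sum of \<open>10\<close> elements of \<open>f(A) - f(A)\<close>, and each \<open>[[x, b], w]\<close> is a sum of \<open>2 \<cdot> 10\<^sup>2\<close> of them.
  If \<open>[[y, b], b]\<close> is invertible for some \<open>y\<close>, the Leibniz rule writes an arbitrary \<open>z\<close> as
  \<open>[p, b] - [q, b][y, b]\<close>, which makes \<open>[z, w]\<close> a sum of \<open>600\<close> elements of \<open>f(A) - f(A)\<close>.

  Such \<open>b\<close> and \<open>y\<close> exist already over \<open>F\<close>, by a hands-on form of Amitsur's theorem that the generic
  matrix algebra embeds in a division algebra: twist the \<open>(i, j)\<close> entries of generic matrices by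
  \<open>u^((j - i) mod n)\<close>. In the algebra of all matrices that are equivariant under the cyclic shift of
  indices and graded in this way, every nonzero element has nonzero determinant.\<close>

section \<open>Commutators and differences of conjugates\<close>

primrec nsums :: "('r, 'm) ring_scheme \<Rightarrow> 'r set \<Rightarrow> nat \<Rightarrow> 'r set" where
  "nsums R S 0 = {\<zero>\<^bsub>R\<^esub>}"
| "nsums R S (Suc k) = {a \<oplus>\<^bsub>R\<^esub> b | a b. a \<in> nsums R S k \<and> b \<in> S}"

context ring
begin

lemma nsums_closed: "S \<subseteq> carrier R \<Longrightarrow> nsums R S k \<subseteq> carrier R"
  by (induction k) auto

lemma nsums_add:
  assumes "S \<subseteq> carrier R" "a \<in> nsums R S k" "b \<in> nsums R S l"
  shows "a \<oplus> b \<in> nsums R S (k + l)"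
  using assms(3)
proof (induction l arbitrary: b)
  case 0
  then show ?case using assms(2) subsetD[OF nsums_closed[OF assms(1)] assms(2)] by simp
next
  case (Suc l)
  then obtain b' s where b: "b = b' \<oplus> s" "b' \<in> nsums R S l" "s \<in> S" by auto
  have "a \<oplus> b = (a \<oplus> b') \<oplus> s"
    using b assms nsums_closed[OF assms(1)] by (simp add: a_assoc subset_iff)
  then show ?case using Suc.IH[OF b(2)] b(3) by auto
qed

lemma nsums_one: "S \<subseteq> carrier R \<Longrightarrow> a \<in> S \<Longrightarrow> a \<in> nsums R S 1"
  by force

text \<open>Shorter sums are padded with zeros. This makes upper bounds for the number of summands
  interchangeable with exact counts.\<close>

lemma nsums_mono:
  assumes "S \<subseteq> carrier R" "\<zero> \<in> S" "k \<le> l"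
  shows "nsums R S k \<subseteq> nsums R S l"
proof -
  have "nsums R S k \<subseteq> nsums R S (Suc k)" for k
    using assms nsums_closed[OF assms(1), of k] by force
  then show ?thesis using \<open>k \<le> l\<close> by (rule lift_Suc_mono_le)
qed

text \<open>Translates the recursive sums, convenient for counting, into indexed finite sums; the
  summand added last becomes the value at index \<open>k\<close>.\<close>

lemma nsums_finsum:
  assumes "S \<subseteq> carrier R" "a \<in> nsums R S k"
  shows "\<exists>t. (\<forall>i<k. t i \<in> S) \<and> a = (\<Oplus>i\<in>{..<k}. t i)"
  using assms(2)
proof (induction k arbitrary: a)
  case 0
  then show ?case by simp
next
  case (Suc k)
  then obtain b s where a: "a = b \<oplus> s" "b \<in> nsums R S k" "s \<in> S" by auto
  from Suc.IH[OF a(2)] obtain t where t: "\<forall>i<k. t i \<in> S" "b = (\<Oplus>i\<in>{..<k}. t i)" by blast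
  let ?t = "t(k := s)"
  have "(\<Oplus>i\<in>{..<Suc k}. ?t i) = ?t k \<oplus> (\<Oplus>i\<in>{..<k}. ?t i)"
    unfolding lessThan_Suc using t a assms(1) by (intro finsum_insert) auto
  also have "(\<Oplus>i\<in>{..<k}. ?t i) = b"
    unfolding t(2) using t(1) assms(1) by (intro finsum_cong') auto
  finally have "a = (\<Oplus>i\<in>{..<Suc k}. ?t i)"
    using a assms(1) nsums_closed[OF assms(1), of k] a_comm[of b s] by auto
  moreover have "\<forall>i<Suc k. ?t i \<in> S"
    using t a by (auto simp: less_Suc_eq)
  ultimately show ?case by blast
qed

section \<open>Brackets, conjugates and elements of square zero\<close>

definition lie :: "'a \<Rightarrow> 'a \<Rightarrow> 'a" where "lie x y = x \<otimes> y \<ominus> y \<otimes> x"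

definition conjugates :: "'a \<Rightarrow> 'a set" where
  "conjugates b = {g \<otimes> b \<otimes> h | g h.
     g \<in> carrier R \<and> h \<in> carrier R \<and> g \<otimes> h = \<one> \<and> h \<otimes> g = \<one>}"

definition conjugate_diffs :: "'a \<Rightarrow> 'a set" where
  "conjugate_diffs b = {x \<ominus> y | x y. x \<in> conjugates b \<and> y \<in> conjugates b}"

definition square_zero :: "'a set" where
  "square_zero = {x \<in> carrier R. x \<otimes> x = \<zero>}"

lemma lie_closed [simp]: "x \<in> carrier R \<Longrightarrow> y \<in> carrier R \<Longrightarrow> lie x y \<in> carrier R"
  by (simp add: lie_def)

lemma square_zero_closed: "square_zero \<subseteq> carrier R"
  by (auto simp: square_zero_def)

lemma conjugates_closed: "b \<in> carrier R \<Longrightarrow> conjugates b \<subseteq> carrier R"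
  by (auto simp: conjugates_def)

lemma conjugate_diffs_closed: "b \<in> carrier R \<Longrightarrow> conjugate_diffs b \<subseteq> carrier R"
  using conjugates_closed by (fastforce simp: conjugate_diffs_def)

lemma self_conjugate: "b \<in> carrier R \<Longrightarrow> b \<in> conjugates b"
  unfolding conjugates_def by (rule CollectI, intro exI[of _ \<one>]) simp

lemma zero_conjugate_diffs: "b \<in> carrier R \<Longrightarrow> \<zero> \<in> conjugate_diffs b"
  unfolding conjugate_diffs_def using self_conjugate[of b]
  by (auto intro!: exI[of _ b] simp: a_minus_def r_neg)

lemma conjugates_trans:
  assumes b: "b \<in> carrier R" and x: "x \<in> conjugates b" and y: "y \<in> conjugates x"
  shows "y \<in> conjugates b"
proof -
  obtain g h where gh: "x = g \<otimes> b \<otimes> h" "g \<in> carrier R" "h \<in> carrier R" "g \<otimes> h = \<one>" "h \<otimes> g = \<one>"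
    using x unfolding conjugates_def by auto
  obtain g' h' where gh': "y = g' \<otimes> x \<otimes> h'" "g' \<in> carrier R" "h' \<in> carrier R"
      "g' \<otimes> h' = \<one>" "h' \<otimes> g' = \<one>"
    using y unfolding conjugates_def by auto
  have "(g' \<otimes> g) \<otimes> (h \<otimes> h') = g' \<otimes> (g \<otimes> h) \<otimes> h'"
    using gh(2,3) gh'(2,3) by (simp add: m_assoc)
  moreover have "(h \<otimes> h') \<otimes> (g' \<otimes> g) = h \<otimes> (h' \<otimes> g') \<otimes> g"
    using gh(2,3) gh'(2,3) by (simp add: m_assoc)
  moreover have "y = (g' \<otimes> g) \<otimes> b \<otimes> (h \<otimes> h')"
    using gh(1-3) gh'(1-3) b by (simp add: m_assoc)
  ultimately show ?thesis
    unfolding conjugates_def using gh(2-5) gh'(2-5)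
    by (intro CollectI exI[of _ "g' \<otimes> g"] exI[of _ "h \<otimes> h'"] conjI) auto
qed

lemma unipotent_inverse:
  assumes "m \<in> square_zero"
  shows "(\<one> \<oplus> m) \<otimes> (\<one> \<ominus> m) = \<one>" "(\<one> \<ominus> m) \<otimes> (\<one> \<oplus> m) = \<one>"
  using assms unfolding square_zero_def a_minus_def
  by (simp_all add: l_distr r_distr r_minus l_minus a_assoc l_neg r_neg a_lcomm[of _ m])

text \<open>With \<open>P = x (1 + m)\<close> the right side is \<open>P - m P\<close>. For matrices
  this splits the conjugation into a column operation followed by a row operation.\<close>

lemma unipotent_conjugate_expand:
  assumes "m \<in> carrier R" "x \<in> carrier R"
  shows "(x \<oplus> x \<otimes> m) \<ominus> m \<otimes> (x \<oplus> x \<otimes> m) = (\<one> \<ominus> m) \<otimes> x \<otimes> (\<one> \<oplus> m)"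
  using assms by (simp add: a_minus_def l_distr r_distr r_minus l_minus minus_add a_ac m_assoc)

lemma lie_conjugate_square_zero:
  assumes b: "b \<in> carrier R" and x: "x \<in> conjugates b" and n: "n \<in> square_zero"
    and h: "h \<in> ring_center R" "h \<oplus> h = \<one>"
  shows "lie n x \<in> conjugate_diffs b"
proof -
  \<comment> \<open>Half of \<open>n\<close>, to absorb the factor 2 in \<open>2[m, x]\<close>. It
    is again of square zero because \<open>h\<close> is central.\<close>
  define m where "m = h \<otimes> n"
  have hc: "h \<in> carrier R" and nc: "n \<in> carrier R" and xc: "x \<in> carrier R" and nn: "n \<otimes> n = \<zero>"
    and comm: "n \<otimes> h = h \<otimes> n"
    using h n x conjugates_closed[OF b] by (auto simp: ring_center_def square_zero_def)
  have mc: "m \<in> carrier R" by (simp add: m_def hc nc)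
  have "m \<otimes> m = h \<otimes> (n \<otimes> h) \<otimes> n" unfolding m_def using hc nc by (simp add: m_assoc)
  also have "\<dots> = h \<otimes> h \<otimes> (n \<otimes> n)" unfolding comm using hc nc by (simp add: m_assoc)
  finally have mm: "m \<in> square_zero" using mc hc by (simp add: nn square_zero_def)
  have n2: "m \<oplus> m = n" unfolding m_def using hc nc h(2) by (simp flip: l_distr)
  let ?p = "(\<one> \<oplus> m) \<otimes> x \<otimes> (\<one> \<ominus> m)" and ?q = "(\<one> \<ominus> m) \<otimes> x \<otimes> (\<one> \<oplus> m)"
  have "?p \<in> conjugates x" "?q \<in> conjugates x"
    unfolding conjugates_def using unipotent_inverse[OF mm] mc by (intro CollectI exI conjI; simp)+
  then have pq: "?p \<in> conjugates b" "?q \<in> conjugates b" using conjugates_trans[OF b x] by auto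
  \<comment> \<open>Both conjugates contain \<open>x - m x m\<close>, which cancels; the mixed terms
    have opposite signs and double.\<close>
  have "?p \<ominus> ?q = (m \<otimes> x \<ominus> x \<otimes> m) \<oplus> (m \<otimes> x \<ominus> x \<otimes> m)"
    using mc xc by (simp add: a_minus_def l_distr r_distr r_minus l_minus minus_add a_ac m_assoc r_neg r_neg2)
  also have "\<dots> = (m \<oplus> m) \<otimes> x \<ominus> x \<otimes> (m \<oplus> m)"
    using mc xc by algebra
  finally have "lie n x = ?p \<ominus> ?q" unfolding n2 lie_def by (rule sym)
  then show ?thesis unfolding conjugate_diffs_def using pq by blast
qed

end

section \<open>Counting in a ring spanned by its center and elements of square zero\<close>

text \<open>Isolates what the counting needs to know about matrices: a central one half, and a
  uniform bound \<open>k\<close> for square-zero decompositions modulo the center. For matrices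
  \<open>k\<close> will be 10.\<close>

locale spanned_by_square_zero = ring R for R (structure) +
  fixes b h :: 'a and k :: nat
  assumes b: "b \<in> carrier R" and half: "h \<in> ring_center R" "h \<oplus> h = \<one>"
    and decomp: "x \<in> carrier R \<Longrightarrow> \<exists>c q. c \<in> ring_center R \<and> q \<in> nsums R square_zero k \<and> x = c \<oplus> q"
begin

abbreviation "S \<equiv> conjugate_diffs b"

lemma lie_sum_square_zero:
  assumes x: "x \<in> conjugates b" and q: "q \<in> nsums R square_zero j"
  shows "lie q x \<in> nsums R S j"
  using q
proof (induction j arbitrary: q)
  case 0
  then show ?case using x conjugates_closed[OF b] by (auto simp: lie_def a_minus_def)
next
  case (Suc j)
  then obtain p s where q: "q = p \<oplus> s" "p \<in> nsums R square_zero j" "s \<in> square_zero" by auto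
  have c: "x \<in> carrier R" "p \<in> carrier R" "s \<in> carrier R"
    using x q nsums_closed[OF square_zero_closed] square_zero_closed conjugates_closed[OF b] by auto
  have "lie q x = lie p x \<oplus> lie s x"
    unfolding lie_def q(1) using c by algebra
  then show ?case using Suc.IH[OF q(2)] lie_conjugate_square_zero[OF b x q(3) half] by auto
qed

text \<open>The central part of \<open>a\<close> does not contribute to the bracket, and each of the
  \<open>k\<close> square-zero parts contributes one difference of conjugates.\<close>

lemma lie_conjugate:
  assumes x: "x \<in> conjugates b" and a: "a \<in> carrier R"
  shows "lie a x \<in> nsums R S k"
proof -
  obtain c q where cq: "c \<in> ring_center R" "q \<in> nsums R square_zero k" "a = c \<oplus> q"
    using decomp[OF a] by blast
  have car: "c \<in> carrier R" "q \<in> carrier R" "x \<in> carrier R" and cx: "c \<otimes> x = x \<otimes> c"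
    using cq x nsums_closed[OF square_zero_closed] conjugates_closed[OF b] by (auto simp: ring_center_def)
  have "lie a x = (c \<otimes> x \<ominus> x \<otimes> c) \<oplus> lie q x"
    unfolding lie_def cq(3) using car by algebra
  also have "\<dots> = lie q x" unfolding cx using car by (simp add: a_minus_def r_neg)
  finally show ?thesis using lie_sum_square_zero[OF x cq(2)] by simp
qed

text \<open>Each summand of \<open>d\<close> is a difference \<open>x - y\<close> of conjugates of
  \<open>b\<close>, and \<open>[x - y, w] = [-w, x] + [w, y]\<close> costs \<open>k + k\<close> by
  \<open>lie_conjugate\<close>.\<close>

lemma lie_nsums:
  assumes "d \<in> nsums R S j" and w: "w \<in> carrier R"
  shows "lie d w \<in> nsums R S (j * (2 * k))"
  using assms(1)
proof (induction j arbitrary: d)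
  case 0
  then show ?case using w by (simp add: lie_def a_minus_def)
next
  case (Suc j)
  then obtain p x y where d: "d = p \<oplus> (x \<ominus> y)" "p \<in> nsums R S j"
      "x \<in> conjugates b" "y \<in> conjugates b"
    by (auto simp: conjugate_diffs_def)
  have c: "p \<in> carrier R" "x \<in> carrier R" "y \<in> carrier R"
    using d nsums_closed[OF conjugate_diffs_closed[OF b]] conjugates_closed[OF b] by auto
  have "lie d w = lie p w \<oplus> (lie (\<ominus> w) x \<oplus> lie w y)"
    unfolding lie_def d(1) using c w by algebra
  moreover have "lie (\<ominus> w) x \<oplus> lie w y \<in> nsums R S (k + k)"
    using d w lie_conjugate nsums_add[OF conjugate_diffs_closed[OF b]] by simp
  ultimately have "lie d w \<in> nsums R S (j * (2 * k) + (k + k))"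
    using Suc.IH[OF d(2)] nsums_add[OF conjugate_diffs_closed[OF b]] by metis
  then show ?case by (simp add: algebra_simps mult_2)
qed

text \<open>The inner bracket is a sum of \<open>k\<close> differences, each of which costs
  \<open>2 k\<close> when bracketed with \<open>w\<close>.\<close>

lemma lie_lie:
  assumes "x \<in> carrier R" "w \<in> carrier R"
  shows "lie (lie x b) w \<in> nsums R S (2 * k\<^sup>2)"
  using lie_nsums[OF lie_conjugate[OF self_conjugate[OF b] assms(1)] assms(2)]
  by (simp add: power2_eq_square algebra_simps)

text \<open>With \<open>D = [_, b]\<close>, the Leibniz rule gives \<open>x D\<^sup>2(y) = D(x D(y)) - D(x) D(y)\<close>; if \<open>D\<^sup>2(y)\<close>
  is invertible, the left side is an arbitrary element.\<close>

theorem lie_in_nsums: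
  assumes y: "y \<in> carrier R" and u: "u \<in> carrier R" "u \<otimes> lie (lie y b) b = \<one>"
    and z: "z \<in> carrier R" and w: "w \<in> carrier R"
  shows "lie z w \<in> nsums R S (6 * k\<^sup>2)"
proof -
  \<comment> \<open>As \<open>u\<close> is a left inverse of \<open>[[y, b], b]\<close>, this choice
    gives \<open>x [[y, b], b] = z\<close>.\<close>
  define x d where "x = z \<otimes> u" and "d = lie y b"
  have xc: "x \<in> carrier R" and dc: "d \<in> carrier R"
    unfolding x_def d_def using y z u b by auto
  have "x \<otimes> lie d b = z \<otimes> (u \<otimes> lie d b)"
    unfolding x_def using z u dc b by (simp add: m_assoc)
  then have "z = x \<otimes> lie d b" using u z by (simp add: d_def)
  also have "\<dots> = lie (x \<otimes> d) b \<ominus> lie x b \<otimes> d"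
    unfolding lie_def using xc dc b by algebra
  finally have zeq: "z = lie (x \<otimes> d) b \<ominus> lie x b \<otimes> d" .
  define e where "e = lie x b"
  have ec: "e \<in> carrier R" and zc: "lie (x \<otimes> d) b \<in> carrier R"
    unfolding e_def using xc dc b by auto
  \<comment> \<open>The identity \<open>[e d, w] = [e, d w] + [d, w e]\<close> turns the bracket of
    a product into brackets whose left entries \<open>e\<close> and \<open>d\<close> are themselves
    brackets with \<open>b\<close>. All three terms then fall under \<open>lie_lie\<close>.\<close>
  have "lie z w = lie (lie (x \<otimes> d) b) w \<oplus> (lie e (d \<otimes> (\<ominus> w)) \<oplus> lie d ((\<ominus> w) \<otimes> e))"
    unfolding zeq e_def[symmetric] unfolding lie_def[of _ w] lie_def[of e] lie_def[of d "_ \<otimes> _"]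
    using ec zc dc w by algebra
  moreover have "lie (lie (x \<otimes> d) b) w \<in> nsums R S (2 * k\<^sup>2)"
    using lie_lie xc dc w by simp
  moreover have "lie e (d \<otimes> (\<ominus> w)) \<in> nsums R S (2 * k\<^sup>2)"
    unfolding e_def using lie_lie xc dc w by simp
  moreover have "lie d ((\<ominus> w) \<otimes> e) \<in> nsums R S (2 * k\<^sup>2)"
    unfolding d_def using lie_lie y ec w by simp
  ultimately have "lie z w \<in> nsums R S (2 * k\<^sup>2 + (2 * k\<^sup>2 + 2 * k\<^sup>2))"
    using nsums_add[OF conjugate_diffs_closed[OF b]] by metis
  then show ?thesis by simp
qed

end

section \<open>Sums of matrices of square zero\<close>

lemma mat_algebra_simps [simp]:
  "carrier (mat_algebra scale n) = carrier_mat n n"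
  "mult (mat_algebra scale n) = (*)"
  "one (mat_algebra scale n) = 1\<^sub>m n"
  "zero (mat_algebra scale n) = 0\<^sub>m n n"
  "add (mat_algebra scale n) = (+)"
  "r \<odot>\<^bsub>mat_algebra scale n\<^esub> x = map_mat (scale r) x"
  by (simp_all add: mat_algebra_def)

lemma mat_algebra_minus:
  assumes "x \<in> carrier_mat n n" "y \<in> carrier_mat n n"
  shows "x \<ominus>\<^bsub>mat_algebra scale n\<^esub> y = x - y"
proof -
  interpret ring "mat_algebra scale n" by (rule ring_mat_algebra)
  have "\<ominus>\<^bsub>mat_algebra scale n\<^esub> y = - y"
    using assms by (intro minus_equality) auto
  then show ?thesis
    unfolding a_minus_def using assms by (auto intro!: eq_matI)
qed

text \<open>Square-zero elements stay so under conjugation: in \<open>g s h g s h\<close> the middle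
  \<open>h g\<close> collapses and leaves \<open>g (s s) h = 0\<close>.\<close>

lemma (in ring) conjugate_nsums_square_zero:
  assumes gh: "g \<in> carrier R" "h \<in> carrier R" "h \<otimes> g = \<one>"
    and q: "q \<in> nsums R square_zero k"
  shows "g \<otimes> q \<otimes> h \<in> nsums R square_zero k"
  using q
proof (induction k arbitrary: q)
  case 0
  then show ?case using gh by simp
next
  case (Suc k)
  then obtain p s where q: "q = p \<oplus> s" "p \<in> nsums R square_zero k" "s \<in> square_zero" by auto
  have c: "p \<in> carrier R" "s \<in> carrier R" and ss: "s \<otimes> s = \<zero>"
    using q nsums_closed[OF square_zero_closed] by (auto simp: square_zero_def)
  have "(g \<otimes> s \<otimes> h) \<otimes> (g \<otimes> s \<otimes> h) = g \<otimes> s \<otimes> (h \<otimes> g) \<otimes> s \<otimes> h"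
    using gh(1,2) c by (simp add: m_assoc)
  also have "\<dots> = g \<otimes> (s \<otimes> s) \<otimes> h" unfolding gh(3) using gh(1,2) c by (simp add: m_assoc)
  also have "\<dots> = \<zero>" using gh unfolding ss by simp
  finally have "g \<otimes> s \<otimes> h \<in> square_zero" using gh c by (simp add: square_zero_def)
  moreover have "g \<otimes> q \<otimes> h = (g \<otimes> p \<otimes> h) \<oplus> (g \<otimes> s \<otimes> h)"
    unfolding q(1) using gh(1,2) c by algebra
  ultimately show ?case using Suc.IH[OF q(2)] by auto
qed

section \<open>The trace\<close>

definition mat_tr :: "'a::comm_monoid_add mat \<Rightarrow> 'a" where
  "mat_tr A = (\<Sum>i<dim_row A. A $$ (i, i))"

lemma mult_mat_entry:
  assumes "A \<in> carrier_mat n n" "B \<in> carrier_mat n n" "i < n" "j < n"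
  shows "(A * B) $$ (i, j) = (\<Sum>l<n. A $$ (i, l) * B $$ (l, j))"
  using assms by (auto simp: scalar_prod_def lessThan_atLeast0 intro!: sum.cong)

lemma mat_tr_mult_commute:
  fixes A B :: "'a::comm_semiring_0 mat"
  assumes "A \<in> carrier_mat n n" "B \<in> carrier_mat n n"
  shows "mat_tr (A * B) = mat_tr (B * A)"
proof -
  have "mat_tr (A * B) = (\<Sum>i<n. \<Sum>l<n. A $$ (i, l) * B $$ (l, i))"
    using assms by (simp add: mat_tr_def mult_mat_entry del: index_mult_mat(1))
  also have "\<dots> = (\<Sum>l<n. \<Sum>i<n. A $$ (i, l) * B $$ (l, i))" by (rule sum.swap)
  also have "\<dots> = mat_tr (B * A)"
    using assms by (simp add: mat_tr_def mult_mat_entry mult.commute del: index_mult_mat(1))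
  finally show ?thesis .
qed

lemma mat_tr_conjugate:
  fixes g :: "'a::{comm_ring,monoid_mult} mat"
  assumes "g \<in> carrier_mat n n" "h \<in> carrier_mat n n" "x \<in> carrier_mat n n" "h * g = 1\<^sub>m n"
  shows "mat_tr (g * x * h) = mat_tr x"
proof -
  \<comment> \<open>The scalar action is a dummy; the interpretation only supplies the unit law for
    matrices over this coefficient ring.\<close>
  interpret ring "mat_algebra (\<lambda>_ :: unit. id :: 'a \<Rightarrow> 'a) n" by (rule ring_mat_algebra)
  have "mat_tr (g * x * h) = mat_tr (h * (g * x))"
    using assms by (intro mat_tr_mult_commute) auto
  also have "h * (g * x) = (h * g) * x" using assms(1-3) by simp
  also have "\<dots> = x" using assms l_one by simp
  finally show ?thesis .
qed

context
  fixes scale :: "'f \<Rightarrow> 'c::{comm_ring,monoid_mult} \<Rightarrow> 'c" and n :: nat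
begin

interpretation ring "mat_algebra scale n" by (rule ring_mat_algebra)

abbreviation "sq_sums \<equiv> nsums (mat_algebra scale n) square_zero"

lemma sq_sums_closed: "q \<in> sq_sums k \<Longrightarrow> q \<in> carrier_mat n n"
  using nsums_closed[OF square_zero_closed] by fastforce

lemma sq_sums_Suc: "p \<in> sq_sums k \<Longrightarrow> s \<in> square_zero \<Longrightarrow> p + s \<in> sq_sums (Suc k)"
  by auto

text \<open>A termwise criterion: in its applications no nonzero entry in column \<open>l\<close>
  meets a nonzero entry in row \<open>l\<close>, so there is no cancellation to consider.\<close>

lemma square_zero_matI:
  assumes "\<And>i j l. i < n \<Longrightarrow> j < n \<Longrightarrow> l < n \<Longrightarrow> f (i, l) * f (l, j) = 0"
  shows "mat n n f \<in> square_zero"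
  unfolding square_zero_def using assms
  by (auto intro!: eq_matI sum.neutral simp: mult_mat_entry[of _ n] simp del: index_mult_mat(1))

lemma square_zero_uminus:
  assumes "x \<in> square_zero"
  shows "- x \<in> square_zero"
  using assms unfolding square_zero_def by auto

text \<open>Squaring commutes with transposition. This reduces lower triangular matrices to upper
  triangular ones.\<close>

lemma transpose_sq_sums: "q \<in> sq_sums k \<Longrightarrow> transpose_mat q \<in> sq_sums k"
proof (induction k arbitrary: q)
  case 0
  then show ?case by simp
next
  case (Suc k)
  then obtain p s where q: "q = p + s" "p \<in> sq_sums k" "s \<in> square_zero" by auto
  have c: "p \<in> carrier_mat n n" "s \<in> carrier_mat n n" "s * s = 0\<^sub>m n n"
    using q sq_sums_closed by (auto simp: square_zero_def)
  have "transpose_mat s * transpose_mat s = 0\<^sub>m n n"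
    using transpose_mult[OF c(2) c(2)] c by simp
  then have "transpose_mat s \<in> square_zero" using c by (simp add: square_zero_def)
  moreover have "transpose_mat q = transpose_mat p + transpose_mat s"
    unfolding q(1) by (rule transpose_add[OF c(1,2)])
  ultimately show ?case using Suc.IH[OF q(2)] by auto
qed

section \<open>Reduction of Hessenberg matrices to companion form\<close>

definition shift_mat :: "(nat \<Rightarrow> bool) \<Rightarrow> 'c mat" where
  "shift_mat P = mat n n (\<lambda>(i, j). if i = Suc j \<and> P j then 1 else 0)"

text \<open>A unit-subdiagonal Hessenberg matrix whose first \<open>k\<close> columns are those of a companion matrix.\<close>

definition hessenberg :: "nat \<Rightarrow> 'c mat \<Rightarrow> bool" where
  "hessenberg k H \<longleftrightarrow> H \<in> carrier_mat n n \<and>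
     (\<forall>i<n. \<forall>j<n. (i > Suc j \<longrightarrow> H $$ (i, j) = 0) \<and> (i = Suc j \<longrightarrow> H $$ (i, j) = 1) \<and>
       (j < k \<and> i \<le> j \<longrightarrow> H $$ (i, j) = 0))"

text \<open>With \<open>v\<close> the part of column \<open>k\<close> on and above the diagonal, conjugation by \<open>1 + v e\<^sup>T\<close>, where
  \<open>e\<close> is the basis vector with index \<open>k + 1\<close>, clears that column.\<close>

lemma hessenberg_step:
  assumes H: "hessenberg k H" and k: "Suc k < n"
  shows "\<exists>g h H'. g \<in> carrier_mat n n \<and> h \<in> carrier_mat n n \<and> g * h = 1\<^sub>m n \<and> h * g = 1\<^sub>m n \<and>
    H = g * H' * h \<and> hessenberg (Suc k) H'"
proof -
  define v where "v = (\<lambda>(i, j). if j = Suc k \<and> i \<le> k then H $$ (i, k) else 0)"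
  define V where "V = mat n n v"
  have sq: "V \<in> square_zero" unfolding V_def by (rule square_zero_matI) (auto simp: v_def)
  have Hc: "H \<in> carrier_mat n n" using H by (simp add: hessenberg_def)
  have Vc: "V \<in> carrier_mat n n" by (simp add: V_def)
  define g h where "g = \<one>\<^bsub>mat_algebra scale n\<^esub> \<oplus>\<^bsub>mat_algebra scale n\<^esub> V"
    and "h = \<one>\<^bsub>mat_algebra scale n\<^esub> \<ominus>\<^bsub>mat_algebra scale n\<^esub> V"
  have gh: "g * h = 1\<^sub>m n" "h * g = 1\<^sub>m n"
    using unipotent_inverse[OF sq] by (simp_all add: g_def h_def)
  have ghc: "g \<in> carrier_mat n n" "h \<in> carrier_mat n n"
    using Vc minus_closed[of "1\<^sub>m n" V] unfolding g_def h_def by simp_all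
  \<comment> \<open>The column operation \<open>P = H (1 + V)\<close> changes only column
    \<open>k + 1\<close>; the row operation \<open>(1 - V) P\<close> then subtracts multiples of row
    \<open>k + 1\<close> from the rows above it.\<close>
  define P where "P = H + H * V"
  define H' where "H' = P - V * P"
  have Pc: "P \<in> carrier_mat n n" and H'c: "H' \<in> carrier_mat n n"
    using Hc Vc by (simp_all add: P_def H'_def minus_carrier_mat)
  have "H' = h * H * g"
  proof -
    let ?R = "mat_algebra scale n"
    have "H \<in> carrier ?R" "V \<in> carrier ?R" using Hc Vc by auto
    from unipotent_conjugate_expand[OF this(2,1)] show ?thesis
      unfolding g_def h_def H'_def P_def using Hc Vc by (simp add: mat_algebra_minus)
  qed
  then have "g * H' * h = g * (h * H * g) * h" by simp
  also have "\<dots> = (g * h) * H * (g * h)"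
    using Hc ghc by (simp add: assoc_mult_mat[of _ n n _ n _ n])
  also have "\<dots> = H" using gh Hc l_one[of H] r_one[of H] by simp
  finally have conj: "H = g * H' * h" by simp
  have HV: "(H * V) $$ (i, j) = (if j = Suc k then \<Sum>l\<le>k. H $$ (i, l) * H $$ (l, k) else 0)"
    if "i < n" "j < n" for i j
  proof -
    have "(H * V) $$ (i, j) = (\<Sum>l<n. H $$ (i, l) * v (l, j))"
      using mult_mat_entry[OF Hc Vc that] that by (simp add: V_def)
    also have "\<dots> = (if j = Suc k then \<Sum>l\<le>k. H $$ (i, l) * H $$ (l, k) else 0)"
      using k by (auto simp: v_def intro!: sum.mono_neutral_cong_right split: if_splits)
    finally show ?thesis .
  qed
  have VP: "(V * P) $$ (i, j) = (if i \<le> k then H $$ (i, k) * P $$ (Suc k, j) else 0)"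
    if "i < n" "j < n" for i j
  proof -
    have "(V * P) $$ (i, j) = (\<Sum>l<n. v (i, l) * P $$ (l, j))"
      using mult_mat_entry[OF Vc Pc that] that by (simp add: V_def)
    also have "\<dots> = (\<Sum>l<n. if l = Suc k then (if i \<le> k then H $$ (i, k) * P $$ (Suc k, j) else 0) else 0)"
      by (intro sum.cong) (auto simp: v_def)
    also have "\<dots> = (if i \<le> k then H $$ (i, k) * P $$ (Suc k, j) else 0)"
      using k by simp
    finally show ?thesis .
  qed
  have Pe: "P $$ (i, j) = H $$ (i, j) + (if j = Suc k then \<Sum>l\<le>k. H $$ (i, l) * H $$ (l, k) else 0)"
    if "i < n" "j < n" for i j
    using HV[OF that] that Hc Vc by (simp add: P_def del: index_mult_mat(1))
  have H'e: "H' $$ (i, j) = P $$ (i, j) - (if i \<le> k then H $$ (i, k) * P $$ (Suc k, j) else 0)"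
    if "i < n" "j < n" for i j
    using VP[OF that] that Pc Vc by (simp add: H'_def del: index_mult_mat(1))
  have h1: "H $$ (i, j) = 0" if "i < n" "j < n" "i > Suc j" for i j
    using H that by (simp add: hessenberg_def)
  have h2: "H $$ (Suc j, j) = 1" if "Suc j < n" for j
    using H that by (simp add: hessenberg_def)
  have h3: "H $$ (i, j) = 0" if "i < n" "j < n" "j < k" "i \<le> j" for i j
    using H that by (simp add: hessenberg_def)
  \<comment> \<open>Below row \<open>k + 1\<close> the first \<open>k + 1\<close> columns of
    \<open>H\<close> vanish, so the column operation preserves the subdiagonal entry of column
    \<open>k + 1\<close> and the zeros below it.\<close>
  have s0: "(\<Sum>l\<le>k. H $$ (i, l) * H $$ (l, k)) = 0" if "i < n" "i > Suc k" for i
    using that k by (intro sum.neutral) (auto simp: h1)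
  have "hessenberg (Suc k) H'"
    unfolding hessenberg_def
  proof (intro conjI allI impI H'c)
    fix i j assume ij: "i < n" "j < n"
    show "H' $$ (i, j) = 0" if "Suc j < i"
      using that ij k by (auto simp: H'e Pe h1 s0)
    show "H' $$ (i, j) = 1" if "i = Suc j"
      using that ij k by (auto simp: H'e Pe h1 h2 s0)
    \<comment> \<open>In column \<open>k\<close> the pivot \<open>P $$ (Suc k, k)\<close> is 1, so
      the row operation removes exactly \<open>H $$ (i, k)\<close>. In earlier columns row
      \<open>k + 1\<close> is zero and nothing changes.\<close>
    show "H' $$ (i, j) = 0" if "j < Suc k \<and> i \<le> j"
      using that ij k by (cases "j = k") (auto simp: H'e Pe h1 h2 h3 s0)
  qed
  then show ?thesis using ghc gh conj by blast
qed

text \<open>Composes the conjugations of the single steps. At \<open>k = n - 1\<close> only the last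
  column is left unreduced, which is companion form.\<close>

lemma hessenberg_companion:
  assumes H: "hessenberg 0 H" and k: "k < n"
  shows "\<exists>g h H'. g \<in> carrier_mat n n \<and> h \<in> carrier_mat n n \<and> g * h = 1\<^sub>m n \<and> h * g = 1\<^sub>m n \<and>
    H = g * H' * h \<and> hessenberg k H'"
  using k
proof (induction k)
  case 0
  have "H = 1\<^sub>m n * H * 1\<^sub>m n" "1\<^sub>m n * 1\<^sub>m n = (1\<^sub>m n :: 'c mat)"
    using H l_one[of H] r_one[of H] l_one[of "1\<^sub>m n"] by (auto simp: hessenberg_def)
  then show ?case using H one_carrier_mat[of n] by blast
next
  case (Suc k)
  then obtain g h H' where 1: "g \<in> carrier_mat n n" "h \<in> carrier_mat n n" "g * h = 1\<^sub>m n" "h * g = 1\<^sub>m n"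
    "H = g * H' * h" "hessenberg k H'" by auto
  obtain g' h' H'' where 2: "g' \<in> carrier_mat n n" "h' \<in> carrier_mat n n" "g' * h' = 1\<^sub>m n"
    "h' * g' = 1\<^sub>m n" "H' = g' * H'' * h'" "hessenberg (Suc k) H''"
    using hessenberg_step[OF 1(6)] Suc.prems by blast
  have c: "H'' \<in> carrier_mat n n" using 2 by (simp add: hessenberg_def)
  have "(g * g') * (h' * h) = g * (g' * h') * h" using 1(1,2) 2(1,2) by (simp add: assoc_mult_mat[of _ n n _ n _ n])
  also have "\<dots> = 1\<^sub>m n" unfolding 2(3) using 1 r_one[of g] by simp
  finally have a: "(g * g') * (h' * h) = 1\<^sub>m n" .
  have "(h' * h) * (g * g') = h' * (h * g) * g'" using 1(1,2) 2(1,2) by (simp add: assoc_mult_mat[of _ n n _ n _ n])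
  also have "\<dots> = 1\<^sub>m n" unfolding 1(4) using 2 r_one[of h'] by simp
  finally have b: "(h' * h) * (g * g') = 1\<^sub>m n" .
  have "H = (g * g') * H'' * (h' * h)" unfolding 1(5) 2(5) using 1(1,2) 2(1,2) c by (simp add: assoc_mult_mat[of _ n n _ n _ n])
  then show ?case
    using a b 2(6) mult_carrier_mat[OF 1(1) 2(1)] mult_carrier_mat[OF 2(2) 1(2)] by blast
qed

section \<open>Decomposition of matrices of trace zero\<close>

text \<open>The entry at \<open>(j + 1, j)\<close> can only be composed with entries in columns
  \<open>j\<close> plus or minus 1, which have the other parity.\<close>

lemma shift_mat_square_zero: "shift_mat even \<in> square_zero" "shift_mat odd \<in> square_zero"
  unfolding shift_mat_def by (rule square_zero_matI; auto)+

lemma shift_mat_split: "shift_mat even + shift_mat odd = shift_mat (\<lambda>_. True)"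
  unfolding shift_mat_def by (rule eq_matI) auto

text \<open>After adding the shift, \<open>A\<close> is conjugate to a companion matrix, the sum of
  the even shift, the odd shift and a last column. These are 3 matrices of square zero; subtracting
  both halves of the added shift makes 5.\<close>

lemma upper_triangular_sq_sums:
  assumes n: "n > 0" and A: "A \<in> carrier_mat n n" and tr: "mat_tr A = 0"
    and upper: "\<And>i j. i < n \<Longrightarrow> j < i \<Longrightarrow> A $$ (i, j) = 0"
  shows "A \<in> sq_sums 5"
proof -
  let ?J = "shift_mat (\<lambda>_. True)"
  have Jc: "shift_mat P \<in> carrier_mat n n" for P by (simp add: shift_mat_def)
  have "hessenberg 0 (A + ?J)"
    using A upper by (auto simp: hessenberg_def shift_mat_def)
  from hessenberg_companion[OF this, of "n - 1"] n
  obtain g h H where gh: "g \<in> carrier_mat n n" "h \<in> carrier_mat n n" "g * h = 1\<^sub>m n" "h * g = 1\<^sub>m n"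
    and AJ: "A + ?J = g * H * h" and hess: "hessenberg (n - 1) H" by auto
  have Hc: "H \<in> carrier_mat n n" using hess by (simp add: hessenberg_def)
  have "mat_tr H = mat_tr (A + ?J)" unfolding AJ using mat_tr_conjugate gh Hc by metis
  also have "\<dots> = mat_tr A"
    using A by (auto simp: mat_tr_def shift_mat_def intro!: sum.cong)
  finally have "mat_tr H = 0" using tr by simp
  \<comment> \<open>The last column is the only one that may have a nonzero diagonal entry.\<close>
  moreover have "mat_tr H = H $$ (n - 1, n - 1)"
  proof -
    have "H $$ (i, i) = 0" if "i \<in> {..<n} - {n - 1}" for i
    proof -
      have "i < n - 1" using that by auto
      with hess n show ?thesis unfolding hessenberg_def by simp
    qed
    then have "mat_tr H = (\<Sum>i\<in>{n - 1}. H $$ (i, i))"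
      unfolding mat_tr_def using Hc n
      by (intro sum.mono_neutral_right ballI) force+
    then show ?thesis by simp
  qed
  ultimately have corner: "H $$ (n - 1, n - 1) = 0" by simp
  define W where "W = mat n n (\<lambda>(i, j). if j = n - 1 then H $$ (i, j) else 0)"
  \<comment> \<open>The trace enters here: a matrix supported in its last column squares to its
    corner entry times itself.\<close>
  have W: "W \<in> square_zero" unfolding W_def by (rule square_zero_matI) (use corner in auto)
  have "?J + W = H"
  proof (rule eq_matI)
    fix i j assume "i < dim_row H" "j < dim_col H"
    then have ij: "i < n" "j < n" using Hc by auto
    have "H $$ (i, j) = (if i = Suc j then 1 else 0)" if "j \<noteq> n - 1"
    proof -
      have j: "j < n - 1" using that ij by simp
      consider "i > Suc j" | "i = Suc j" | "i \<le> j" by linarith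
      then show ?thesis using hess ij j unfolding hessenberg_def by cases simp_all
    qed
    then show "(?J + W) $$ (i, j) = H $$ (i, j)"
      using ij by (auto simp: shift_mat_def W_def)
  qed (use Hc in \<open>auto simp: W_def\<close>)
  then have H: "shift_mat even + shift_mat odd + W = H" by (simp add: shift_mat_split)
  have "shift_mat even \<in> sq_sums 1"
    using nsums_one[OF square_zero_closed shift_mat_square_zero(1)] .
  then have "shift_mat even + shift_mat odd + W \<in> sq_sums (Suc (Suc 1))"
    by (intro sq_sums_Suc shift_mat_square_zero W)
  then have "H \<in> sq_sums 3" by (simp add: H numeral_3_eq_3 del: nsums.simps)
  then have "g * H * h \<in> sq_sums 3"
    using conjugate_nsums_square_zero[of g h H 3] gh by simp
  then have "A + ?J \<in> sq_sums 3" by (simp add: AJ)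
  moreover have "A = (A + ?J) + - shift_mat even + - shift_mat odd"
    using A by (auto simp: shift_mat_def intro!: eq_matI)
  ultimately have "A \<in> sq_sums (Suc (Suc 3))"
    using sq_sums_Suc shift_mat_square_zero[THEN square_zero_uminus] by metis
  then show ?thesis by simp
qed

text \<open>The upper part keeps the diagonal and hence the trace; the strictly lower part has trace
  zero by itself. Each takes 5 summands.\<close>

lemma trace_zero_sq_sums:
  assumes n: "n > 0" and A: "A \<in> carrier_mat n n" and tr: "mat_tr A = 0"
  shows "A \<in> sq_sums 10"
proof -
  define U L where "U = mat n n (\<lambda>(i, j). if i \<le> j then A $$ (i, j) else 0)"
    and "L = mat n n (\<lambda>(i, j). if j < i then A $$ (i, j) else 0)"
  have "mat_tr U = mat_tr A" using A by (auto simp: mat_tr_def U_def intro!: sum.cong)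
  then have "U \<in> sq_sums 5"
    using tr by (intro upper_triangular_sq_sums[OF n]) (auto simp: U_def)
  moreover have "transpose_mat L \<in> sq_sums 5"
    by (intro upper_triangular_sq_sums[OF n]) (auto simp: L_def mat_tr_def intro!: sum.neutral)
  then have "transpose_mat (transpose_mat L) \<in> sq_sums 5" by (rule transpose_sq_sums)
  ultimately have "U + L \<in> sq_sums (5 + 5)"
    using nsums_add[OF square_zero_closed, of U 5 L 5] by simp
  also have "U + L = A" using A by (auto simp: U_def L_def intro!: eq_matI)
  finally show ?thesis by simp
qed

end

section \<open>Splitting off a scalar matrix\<close>

definition scalar_matrix :: "nat \<Rightarrow> 'a::zero \<Rightarrow> 'a mat" where
  "scalar_matrix n s = mat n n (\<lambda>(i, j). if i = j then s else 0)"

lemma scalar_matrix_center: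
  "scalar_matrix n s \<in> ring_center (mat_algebra scale n)"
proof -
  have sc: "scalar_matrix n s \<in> carrier_mat n n" by (simp add: scalar_matrix_def)
  have "scalar_matrix n s * x = x * scalar_matrix n s" if x: "x \<in> carrier_mat n n" for x
  proof (rule eq_matI)
    fix i j assume "i < dim_row (x * scalar_matrix n s)" "j < dim_col (x * scalar_matrix n s)"
    then have ij: "i < n" "j < n" using x by (auto simp: scalar_matrix_def)
    have "(scalar_matrix n s * x) $$ (i, j) = (\<Sum>l<n. if l = i then s * x $$ (l, j) else 0)"
      unfolding mult_mat_entry[OF sc x ij] using ij by (intro sum.cong) (auto simp: scalar_matrix_def)
    also have "\<dots> = s * x $$ (i, j)" using ij by simp
    also have "\<dots> = (\<Sum>l<n. if l = j then x $$ (i, l) * s else 0)"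
      using ij by (simp add: mult.commute)
    also have "\<dots> = (x * scalar_matrix n s) $$ (i, j)"
      unfolding mult_mat_entry[OF x sc ij] using ij by (intro sum.cong) (auto simp: scalar_matrix_def)
    finally show "(scalar_matrix n s * x) $$ (i, j) = (x * scalar_matrix n s) $$ (i, j)" .
  qed (use x in \<open>auto simp: scalar_matrix_def\<close>)
  then show ?thesis by (auto simp: ring_center_def scalar_matrix_def)
qed

text \<open>In characteristic zero \<open>n\<close> is invertible, so subtracting the scalar matrix
  with entry \<open>tr A / n\<close> leaves trace zero.\<close>

lemma central_plus_sq_sums:
  fixes scale :: "'f::field_char_0 \<Rightarrow> 'c::{comm_ring,monoid_mult} \<Rightarrow> 'c"
  assumes n: "n > 0" and alg: "comm_unital_algebra scale" and A: "A \<in> carrier_mat n n"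
  shows "\<exists>c q. c \<in> ring_center (mat_algebra scale n) \<and> q \<in> sq_sums scale n 10 \<and> A = c + q"
proof -
  interpret comm_unital_algebra scale by (rule alg)
  define s where "s = scale (1 / of_nat n) (mat_tr A)"
  define c where "c = scalar_matrix n s"
  have cc: "c \<in> carrier_mat n n" by (simp add: c_def scalar_matrix_def)
  have "(\<Sum>i<n. s) = scale (\<Sum>i<n. 1 / of_nat n) (mat_tr A)"
    unfolding s_def by (rule scale_sum_left[symmetric])
  also have "\<dots> = mat_tr A" using n by simp
  finally have "mat_tr (A - c) = 0"
    using A cc by (simp add: mat_tr_def c_def scalar_matrix_def sum_subtractf)
  then have "A - c \<in> sq_sums scale n 10"
    using A cc by (intro trace_zero_sq_sums[OF n]) auto
  moreover have "A = c + (A - c)" using A cc by (auto intro!: eq_matI)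
  ultimately show ?thesis using scalar_matrix_center[of n s scale] unfolding c_def by blast
qed

section \<open>Evaluation of noncommutative polynomials\<close>

lemma word_eval_Nil [simp]: "word_eval R a (Word []) = \<one>\<^bsub>R\<^esub>"
  by (simp add: word_eval_def)

lemma word_eval_Cons [simp]:
  "word_eval R a (Word (i # is)) = a i \<otimes>\<^bsub>R\<^esub> word_eval R a (Word is)"
  by (simp add: word_eval_def)

text \<open>Induction along the construction of \<open>f\<close> for properties of a whole family.
  It is phrased this way for \<open>twisted n\<close>, which relates values at different parameters
  and is not pointwise.\<close>

lemma nc_eval_family:
  fixes R :: "('f::zero, 'r, 'm) module_scheme" (structure)
  assumes "ring R" and closed: "\<And>x p. P x \<Longrightarrow> x p \<in> carrier R"
    and zero: "P (\<lambda>_. \<zero>)" and one: "P (\<lambda>_. \<one>)"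
    and add: "\<And>x y. P x \<Longrightarrow> P y \<Longrightarrow> P (\<lambda>p. x p \<oplus> y p)"
    and mult: "\<And>x y. P x \<Longrightarrow> P y \<Longrightarrow> P (\<lambda>p. x p \<otimes> y p)"
    and smult: "\<And>r x. P x \<Longrightarrow> P (\<lambda>p. r \<odot> x p)"
    and X: "\<And>i. P (X i)"
  shows "P (\<lambda>p. nc_eval R (\<lambda>i. X i p) f)"
proof -
  interpret ring R by fact
  have w: "P (\<lambda>p. word_eval R (\<lambda>i. X i p) (Word ls))" for ls
    by (induction ls) (auto intro: one mult X)
  have t: "P (\<lambda>p. r \<odot> word_eval R (\<lambda>i. X i p) v)" for r v
    by (cases v) (auto intro: smult w)
  have "P (\<lambda>p. \<Oplus>v\<in>A. Poly_Mapping.lookup f v \<odot> word_eval R (\<lambda>i. X i p) v)" if "finite A" for A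
    using that
  proof (induction A rule: finite_induct)
    case empty
    then show ?case by (simp add: zero)
  next
    case (insert v A)
    let ?g = "\<lambda>p v. Poly_Mapping.lookup f v \<odot> word_eval R (\<lambda>i. X i p) v"
    have "(\<Oplus>v\<in>insert v A. ?g p v) = ?g p v \<oplus> (\<Oplus>v\<in>A. ?g p v)" for p
      using insert closed[OF t] by (intro finsum_insert) auto
    then show ?case using add[OF t insert.IH] by simp
  qed
  then show ?thesis unfolding nc_eval_def by simp
qed

lemma nc_eval_closed:
  assumes "ring R" and "\<And>r x. x \<in> carrier R \<Longrightarrow> r \<odot>\<^bsub>R\<^esub> x \<in> carrier R"
    and "\<And>i. a i \<in> carrier R"
  shows "nc_eval R a f \<in> carrier R"
proof -
  interpret ring R by fact
  have "(\<forall>p :: unit. nc_eval R (\<lambda>i. (\<lambda>_. a i) p) f \<in> carrier R)"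
    by (rule nc_eval_family[where P = "\<lambda>x. \<forall>p. x p \<in> carrier R" and X = "\<lambda>i _. a i"])
      (use assms in auto)
  then show ?thesis by simp
qed

text \<open>Serves three homomorphisms: conjugation, specialization of the polynomial variable, and
  the passage from \<open>F\<close> to \<open>C\<close> on entries.\<close>

lemma nc_eval_hom:
  assumes "ring R" "ring R'" and hom: "\<phi> \<in> ring_hom R R'"
    and smult: "\<And>r x. x \<in> carrier R \<Longrightarrow> r \<odot>\<^bsub>R\<^esub> x \<in> carrier R"
    and hom_smult: "\<And>r x. x \<in> carrier R \<Longrightarrow> \<phi> (r \<odot>\<^bsub>R\<^esub> x) = r \<odot>\<^bsub>R'\<^esub> \<phi> x"
    and a: "\<And>i. a i \<in> carrier R"
  shows "\<phi> (nc_eval R a f) = nc_eval R' (\<lambda>i. \<phi> (a i)) f"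
proof -
  interpret R: ring R by fact
  interpret R': ring R' by fact
  interpret ring_hom_ring R R' \<phi> by (rule ring_hom_ringI2) fact+
  have w: "word_eval R a (Word ls) \<in> carrier R \<and>
      \<phi> (word_eval R a (Word ls)) = word_eval R' (\<lambda>i. \<phi> (a i)) (Word ls)" for ls
    by (induction ls) (auto simp: a)
  let ?g = "\<lambda>v. Poly_Mapping.lookup f v \<odot>\<^bsub>R\<^esub> word_eval R a v"
  let ?g' = "\<lambda>v. Poly_Mapping.lookup f v \<odot>\<^bsub>R'\<^esub> word_eval R' (\<lambda>i. \<phi> (a i)) v"
  have g: "?g v \<in> carrier R" "\<phi> (?g v) = ?g' v" for v
    using w by (cases v, auto intro: smult simp: hom_smult)+
  have g': "?g' v \<in> carrier R'" for v
    using g[of v] hom_closed by metis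
  have "\<phi> (\<Oplus>\<^bsub>R\<^esub>v\<in>A. ?g v) = (\<Oplus>\<^bsub>R'\<^esub>v\<in>A. ?g' v)" if "finite A" for A
    using that
  proof (induction A rule: finite_induct)
    case (insert v A)
    then show ?case using g g' by (simp add: R.finsum_insert R'.finsum_insert Pi_def)
  qed simp
  then show ?thesis unfolding nc_eval_def by simp
qed

lemma map_mat_ring_hom:
  fixes \<theta> :: "'a::{comm_ring,monoid_mult} \<Rightarrow> 'b::{comm_ring,monoid_mult}"
  assumes add: "\<And>x y. \<theta> (x + y) = \<theta> x + \<theta> y" and mult: "\<And>x y. \<theta> (x * y) = \<theta> x * \<theta> y"
    and one: "\<theta> 1 = 1"
  shows "map_mat \<theta> \<in> ring_hom (mat_algebra s n) (mat_algebra s' n)"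
proof (rule ring_hom_memI)
  have zero: "\<theta> 0 = 0" using add[of 0 0] by simp
  have sum: "\<theta> (sum g A) = (\<Sum>x\<in>A. \<theta> (g x))" for g and A :: "nat set"
    by (induction A rule: infinite_finite_induct) (auto simp: zero add)
  show "map_mat \<theta> \<one>\<^bsub>mat_algebra s n\<^esub> = \<one>\<^bsub>mat_algebra s' n\<^esub>"
    by (auto intro!: eq_matI simp: one zero)
  fix x y assume "x \<in> carrier (mat_algebra s n)" "y \<in> carrier (mat_algebra s n)"
  then have xy: "x \<in> carrier_mat n n" "y \<in> carrier_mat n n" by simp_all
  show "map_mat \<theta> (x \<otimes>\<^bsub>mat_algebra s n\<^esub> y) = map_mat \<theta> x \<otimes>\<^bsub>mat_algebra s' n\<^esub> map_mat \<theta> y"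
    using xy by (auto intro!: eq_matI simp: mult_mat_entry[of _ n] sum mult simp del: index_mult_mat(1))
  show "map_mat \<theta> (x \<oplus>\<^bsub>mat_algebra s n\<^esub> y) = map_mat \<theta> x \<oplus>\<^bsub>mat_algebra s' n\<^esub> map_mat \<theta> y"
    using xy by (auto intro!: eq_matI simp: add)
qed auto

lemma lie_hom:
  assumes "ring R" "ring R'" and hom: "\<phi> \<in> ring_hom R R'"
    and xy: "x \<in> carrier R" "y \<in> carrier R"
  shows "\<phi> (ring.lie R x y) = ring.lie R' (\<phi> x) (\<phi> y)"
proof -
  interpret R: ring R by fact
  interpret R': ring R' by fact
  interpret ring_hom_ring R R' \<phi> by (rule ring_hom_ringI2) fact+
  show ?thesis using xy by (simp add: R.lie_def R'.lie_def a_minus_def)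
qed

section \<open>Generic matrices of cyclic type\<close>

text \<open>This weak form of being a polynomial function suffices to show that the product of nonzero
  functions is nonzero, without multivariate polynomials.\<close>

definition line_poly :: "(('i \<Rightarrow> 'f::field_char_0) \<Rightarrow> 'f) \<Rightarrow> bool" where
  "line_poly p \<longleftrightarrow> (\<forall>a b. \<exists>q. \<forall>s. p (\<lambda>x. a x + s * b x) = poly q s)"

lemma line_poly_const: "line_poly (\<lambda>_. c)"
  unfolding line_poly_def by (intro allI exI[of _ "[:c:]"]) simp

lemma line_poly_coord: "line_poly (\<lambda>t. t x)"
  unfolding line_poly_def
proof (intro allI)
  fix a b :: "'a \<Rightarrow> 'b"
  show "\<exists>q. \<forall>s. a x + s * b x = poly q s"
    by (rule exI[of _ "[:a x, b x:]"]) simp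
qed

lemma line_poly_add:
  assumes "line_poly p" "line_poly q"
  shows "line_poly (\<lambda>t. p t + q t)"
  unfolding line_poly_def
proof (intro allI)
  fix a b :: "'a \<Rightarrow> 'b"
  obtain p' q' where "\<forall>s. p (\<lambda>x. a x + s * b x) = poly p' s" "\<forall>s. q (\<lambda>x. a x + s * b x) = poly q' s"
    using assms unfolding line_poly_def by meson
  then show "\<exists>r. \<forall>s. p (\<lambda>x. a x + s * b x) + q (\<lambda>x. a x + s * b x) = poly r s"
    by (intro exI[of _ "p' + q'"]) simp
qed

lemma line_poly_mult:
  assumes "line_poly p" "line_poly q"
  shows "line_poly (\<lambda>t. p t * q t)"
  unfolding line_poly_def
proof (intro allI)
  fix a b :: "'a \<Rightarrow> 'b"
  obtain p' q' where "\<forall>s. p (\<lambda>x. a x + s * b x) = poly p' s" "\<forall>s. q (\<lambda>x. a x + s * b x) = poly q' s"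
    using assms unfolding line_poly_def by meson
  then show "\<exists>r. \<forall>s. p (\<lambda>x. a x + s * b x) * q (\<lambda>x. a x + s * b x) = poly r s"
    by (intro exI[of _ "p' * q'"]) simp
qed

lemma line_poly_sum: "(\<And>i. i \<in> A \<Longrightarrow> line_poly (p i)) \<Longrightarrow> line_poly (\<lambda>t. \<Sum>i\<in>A. p i t)"
  by (induction A rule: infinite_finite_induct) (auto intro: line_poly_const line_poly_add)

lemma line_poly_prod: "(\<And>i. i \<in> A \<Longrightarrow> line_poly (p i)) \<Longrightarrow> line_poly (\<lambda>t. \<Prod>i\<in>A. p i t)"
  by (induction A rule: infinite_finite_induct) (auto intro: line_poly_const line_poly_mult)

text \<open>On the line with \<open>t\<close> at \<open>s = 0\<close> and \<open>t'\<close> at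
  \<open>s = 1\<close>, both functions are nonzero polynomials in \<open>s\<close>, and so is their
  product; over an infinite field it has a nonzero value.\<close>

lemma line_poly_mult_nonzero:
  assumes p: "line_poly p" "p t \<noteq> 0" and q: "line_poly q" "q t' \<noteq> 0"
  shows "\<exists>t. p t * q t \<noteq> 0"
proof -
  let ?l = "\<lambda>s x. t x + s * (t' x - t x)"
  obtain p' q' where p': "\<And>s. p (?l s) = poly p' s" and q': "\<And>s. q (?l s) = poly q' s"
    using p(1) q(1) unfolding line_poly_def by meson
  have "p' \<noteq> 0" using p(2) p'[of 0] by auto
  moreover have "q' \<noteq> 0" using q(2) q'[of 1] by auto
  ultimately have "p' * q' \<noteq> 0" by simp
  then obtain s where "poly (p' * q') s \<noteq> 0" using poly_all_0_iff_0 by blast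
  then have "p (?l s) * q (?l s) \<noteq> 0" by (simp add: p' q')
  then show ?thesis by blast
qed

lemma line_poly_prod_nonzero:
  assumes "finite A" "\<And>i. i \<in> A \<Longrightarrow> line_poly (p i)" "\<And>i. i \<in> A \<Longrightarrow> \<exists>t. p i t \<noteq> 0"
  shows "\<exists>t. (\<Prod>i\<in>A. p i t) \<noteq> 0"
  using assms
proof (induction A rule: finite_induct)
  case (insert i A)
  obtain t where "p i t \<noteq> 0" using insert.prems by blast
  moreover obtain t' where "(\<Prod>i\<in>A. p i t') \<noteq> 0" using insert by auto
  moreover have "line_poly (\<lambda>t. \<Prod>i\<in>A. p i t)" using insert.prems by (intro line_poly_prod) auto
  ultimately show ?case
    using line_poly_mult_nonzero[of "p i" t "\<lambda>t. \<Prod>i\<in>A. p i t" t'] insert by auto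
qed simp

section \<open>Matrices equivariant under the cyclic shift of indices and graded by index
  differences\<close>

definition shift_params :: "nat \<Rightarrow> (nat \<times> nat \<times> nat \<Rightarrow> 'f) \<Rightarrow> nat \<times> nat \<times> nat \<Rightarrow> 'f" where
  "shift_params n t = (\<lambda>(v, i, j). t (v, Suc i mod n, Suc j mod n))"

text \<open>Essentially an order in a generic cyclic algebra of degree \<open>n\<close>: the parameters
  \<open>t (v, i, j)\<close> are the entries of the \<open>v\<close>-th generic matrix, and \<open>u^n\<close> (with \<open>u\<close> the polynomial
  variable) is the central parameter of the cyclic algebra.\<close>

definition twisted :: "nat \<Rightarrow> ((nat \<times> nat \<times> nat \<Rightarrow> 'f) \<Rightarrow> 'f::field_char_0 poly mat) \<Rightarrow> bool" where
  "twisted n M \<longleftrightarrow>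
     (\<forall>t. M t \<in> carrier_mat n n) \<and>
     (\<forall>t. \<forall>i<n. \<forall>j<n. M t $$ (Suc i mod n, Suc j mod n) = M (shift_params n t) $$ (i, j)) \<and>
     (\<forall>i<n. \<forall>j<n. \<forall>k. line_poly (\<lambda>t. coeff (M t $$ (i, j)) k)) \<and>
     (\<forall>t. \<forall>i<n. \<forall>j<n. \<forall>k. coeff (M t $$ (i, j)) k \<noteq> 0 \<longrightarrow> (i + k) mod n = j)"

lemma twistedI:
  assumes "\<And>t. M t \<in> carrier_mat n n"
    and "\<And>t i j. i < n \<Longrightarrow> j < n \<Longrightarrow> M t $$ (Suc i mod n, Suc j mod n) = M (shift_params n t) $$ (i, j)"
    and "\<And>i j k. i < n \<Longrightarrow> j < n \<Longrightarrow> line_poly (\<lambda>t. coeff (M t $$ (i, j)) k)"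
    and "\<And>t i j k. i < n \<Longrightarrow> j < n \<Longrightarrow> coeff (M t $$ (i, j)) k \<noteq> 0 \<Longrightarrow> (i + k) mod n = j"
  shows "twisted n M"
  using assms unfolding twisted_def by blast

lemma twistedD:
  assumes "twisted n M"
  shows "M t \<in> carrier_mat n n"
    and "i < n \<Longrightarrow> j < n \<Longrightarrow> M t $$ (Suc i mod n, Suc j mod n) = M (shift_params n t) $$ (i, j)"
    and "i < n \<Longrightarrow> j < n \<Longrightarrow> line_poly (\<lambda>t. coeff (M t $$ (i, j)) k)"
    and "i < n \<Longrightarrow> j < n \<Longrightarrow> coeff (M t $$ (i, j)) k \<noteq> 0 \<Longrightarrow> (i + k) mod n = j"
  using assms unfolding twisted_def by blast+

lemma Suc_mod_eq_iff:
  assumes "i < n" "j < n"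
  shows "Suc i mod n = Suc j mod n \<longleftrightarrow> i = j"
  using assms by (auto simp: mod_Suc)

lemma add_mod_eq_iff:
  fixes i j k n :: nat
  assumes "i < n" "j < n"
  shows "(i + k) mod n = (j + k) mod n \<longleftrightarrow> i = j"
proof (induction k)
  case (Suc k)
  have "n > 0" using assms by simp
  then show ?case
    using Suc Suc_mod_eq_iff[of "(i + k) mod n" n "(j + k) mod n"] by (simp add: mod_Suc_eq)
qed (use assms in simp)

lemma bij_betw_Suc_mod: "bij_betw (\<lambda>i. Suc i mod n) {..<n} {..<n}"
proof -
  have inj: "inj_on (\<lambda>i. Suc i mod n) {..<n}" by (auto intro!: inj_onI simp: Suc_mod_eq_iff)
  have "(\<lambda>i. Suc i mod n) ` {..<n} \<subseteq> {..<n}" by (auto intro!: mod_less_divisor)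
  then show ?thesis using inj endo_inj_surj[of "{..<n}"] unfolding bij_betw_def by blast
qed

lemma twisted_zero: "twisted n (\<lambda>_. 0\<^sub>m n n)"
  by (rule twistedI) (auto intro: line_poly_const)

lemma twisted_one: "twisted n (\<lambda>_. 1\<^sub>m n)"
  by (rule twistedI) (auto intro: line_poly_const simp: Suc_mod_eq_iff coeff_1 split: if_splits)

lemma twisted_add:
  assumes "twisted n M" "twisted n N"
  shows "twisted n (\<lambda>t. M t + N t)"
proof (rule twistedI)
  note M = twistedD[OF assms(1)] and N = twistedD[OF assms(2)]
  have e: "(M t + N t) $$ (i, j) = M t $$ (i, j) + N t $$ (i, j)" if "i < n" "j < n" for t i j
    using that M(1)[of t] N(1)[of t] by simp
  show "M t + N t \<in> carrier_mat n n" for t using N(1) by simp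
  fix t i j k assume ij: "i < n" "j < n"
  then have "n > 0" by simp
  then show "(M t + N t) $$ (Suc i mod n, Suc j mod n) =
      (M (shift_params n t) + N (shift_params n t)) $$ (i, j)"
    using ij M(2) N(2) by (simp add: e)
  show "line_poly (\<lambda>t. coeff ((M t + N t) $$ (i, j)) k)"
    using ij M(3) N(3) by (simp add: e line_poly_add)
  show "(i + k) mod n = j" if "coeff ((M t + N t) $$ (i, j)) k \<noteq> 0"
    using that ij M(4) N(4) by (simp add: e) (metis add_0)
qed

lemma twisted_smult:
  assumes "twisted n M"
  shows "twisted n (\<lambda>t. map_mat (Polynomial.smult r) (M t))"
proof (rule twistedI)
  note M = twistedD[OF assms(1)]
  have e: "map_mat (Polynomial.smult r) (M t) $$ (i, j) = Polynomial.smult r (M t $$ (i, j))"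
    if "i < n" "j < n" for t i j
    using that M(1)[of t] by simp
  show "map_mat (Polynomial.smult r) (M t) \<in> carrier_mat n n" for t using M(1) by simp
  fix t i j k assume ij: "i < n" "j < n"
  then have "n > 0" by simp
  then show "map_mat (Polynomial.smult r) (M t) $$ (Suc i mod n, Suc j mod n) =
      map_mat (Polynomial.smult r) (M (shift_params n t)) $$ (i, j)"
    using ij M(2) by (simp add: e)
  show "line_poly (\<lambda>t. coeff (map_mat (Polynomial.smult r) (M t) $$ (i, j)) k)"
    using ij M(3) by (simp add: e line_poly_mult line_poly_const)
  show "(i + k) mod n = j" if "coeff (map_mat (Polynomial.smult r) (M t) $$ (i, j)) k \<noteq> 0"
    using that ij M(4)[of i j t k] by (auto simp: e)
qed

text \<open>Equivariance follows by shifting the summation index cyclically. For the grading,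
  degrees \<open>m\<close> from row \<open>i\<close> to \<open>l\<close> and \<open>k - m\<close>
  from \<open>l\<close> to \<open>j\<close> add up to \<open>k\<close> from \<open>i\<close> to
  \<open>j\<close>.\<close>

lemma twisted_mult:
  assumes "twisted n M" "twisted n N"
  shows "twisted n (\<lambda>t. M t * N t)"
proof (rule twistedI)
  note M = twistedD[OF assms(1)] and N = twistedD[OF assms(2)]
  have e: "(M t * N t) $$ (i, j) = (\<Sum>l<n. M t $$ (i, l) * N t $$ (l, j))" if "i < n" "j < n" for t i j
    by (rule mult_mat_entry) (use that M(1) N(1) in auto)
  have ce: "coeff ((M t * N t) $$ (i, j)) k =
      (\<Sum>l<n. \<Sum>m\<le>k. coeff (M t $$ (i, l)) m * coeff (N t $$ (l, j)) (k - m))" if "i < n" "j < n" for t i j k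
    using that by (simp add: e coeff_sum coeff_mult)
  show "M t * N t \<in> carrier_mat n n" for t using M(1) N(1) by (meson mult_carrier_mat)
  fix t i j k assume ij: "i < n" "j < n"
  then have n: "n > 0" by simp
  then have "(M t * N t) $$ (Suc i mod n, Suc j mod n) =
      (\<Sum>l<n. M t $$ (Suc i mod n, l) * N t $$ (l, Suc j mod n))" by (simp add: e)
  also have "\<dots> = (\<Sum>l<n. M t $$ (Suc i mod n, Suc l mod n) * N t $$ (Suc l mod n, Suc j mod n))"
    by (rule sum.reindex_bij_betw[OF bij_betw_Suc_mod, symmetric])
  also have "\<dots> = (M (shift_params n t) * N (shift_params n t)) $$ (i, j)"
    using ij M(2) N(2) by (simp add: e)
  finally show "(M t * N t) $$ (Suc i mod n, Suc j mod n) =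
      (M (shift_params n t) * N (shift_params n t)) $$ (i, j)" .
  show "line_poly (\<lambda>t. coeff ((M t * N t) $$ (i, j)) k)"
    unfolding ce[OF ij] using ij M(3) N(3) by (intro line_poly_sum line_poly_mult) auto
  show "(i + k) mod n = j" if nz: "coeff ((M t * N t) $$ (i, j)) k \<noteq> 0"
  proof -
    obtain l m where lm: "l < n" "m \<le> k" "coeff (M t $$ (i, l)) m \<noteq> 0" "coeff (N t $$ (l, j)) (k - m) \<noteq> 0"
      using nz unfolding ce[OF ij] by (fastforce elim!: sum.not_neutral_contains_not_neutral)
    have "(i + m) mod n = l" "(l + (k - m)) mod n = j" using lm ij M(4) N(4) by blast+
    moreover have "((i + m) mod n + (k - m)) mod n = (i + k) mod n"
      using lm(2) by (subst mod_add_left_eq) simp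
    ultimately show ?thesis by simp
  qed
qed

text \<open>The exponent is \<open>j - i\<close> modulo \<open>n\<close>; adding \<open>n\<close>
  first avoids truncated subtraction. At \<open>u = 1\<close> this is the ordinary generic
  matrix.\<close>

definition twisted_generic :: "nat \<Rightarrow> nat \<Rightarrow> (nat \<times> nat \<times> nat \<Rightarrow> 'f::zero) \<Rightarrow> 'f poly mat" where
  "twisted_generic n v t = mat n n (\<lambda>(i, j). monom (t (v, i, j)) ((n + j - i) mod n))"

lemma twisted_generic: "twisted n (twisted_generic n v)"
proof (rule twistedI)
  show "twisted_generic n v t \<in> carrier_mat n n" for t :: "nat \<times> nat \<times> nat \<Rightarrow> 'a"
    by (simp add: twisted_generic_def)
  fix t :: "nat \<times> nat \<times> nat \<Rightarrow> 'a" and i j k assume ij: "i < n" "j < n"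
  then have n: "n > 0" by simp
  have "(n + Suc j mod n - Suc i mod n) mod n = (n + j - i) mod n"
  proof -
    consider "Suc i < n" "Suc j < n" | "Suc i = n" "Suc j < n" | "Suc i < n" "Suc j = n"
      | "Suc i = n" "Suc j = n" using ij by linarith
    then show ?thesis
    proof cases
      case 2
      then have "Suc i mod n = 0" "n + j - i = Suc j" by simp_all
      then show ?thesis by (simp only: diff_zero mod_add_self1 mod_mod_trivial)
    next
      case 3
      then have "n + j - i = n + (n - Suc i)" by simp
      then have "(n + j - i) mod n = (n - Suc i) mod n" by (simp only: mod_add_self1)
      then show ?thesis using 3 by simp
    qed auto
  qed
  then show "twisted_generic n v t $$ (Suc i mod n, Suc j mod n) =
      twisted_generic n v (shift_params n t) $$ (i, j)"
    using ij n by (simp add: twisted_generic_def shift_params_def)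
  show "line_poly (\<lambda>t. coeff (twisted_generic n v t $$ (i, j)) k)"
    using ij by (cases "(n + j - i) mod n = k") (simp_all add: twisted_generic_def line_poly_const line_poly_coord)
  show "(i + k) mod n = j" if "coeff (twisted_generic n v t $$ (i, j)) k \<noteq> 0"
  proof -
    have "k = (n + j - i) mod n"
      using that ij by (simp add: twisted_generic_def split: if_splits)
    then have "(i + k) mod n = (i + (n + j - i)) mod n" by (simp only: mod_add_right_eq)
    then show ?thesis using ij by simp
  qed
qed

text \<open>The matrix of lowest-order coefficients in the polynomial variable has one entry in each row
  and column, and these entries are shifts of one another; so its determinant is generically nonzero.\<close>

lemma twisted_det_nonzero:
  assumes M: "twisted n M" and nz: "i0 < n" "j0 < n" "M t0 $$ (i0, j0) \<noteq> 0"
  shows "\<exists>t u. det (map_mat (\<lambda>p. poly p u) (M t)) \<noteq> 0"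
proof -
  note M = twistedD[OF M]
  have n: "n > 0" using nz by simp
  define Q where "Q = (\<lambda>k. \<exists>t i j. i < n \<and> j < n \<and> coeff (M t $$ (i, j)) k \<noteq> 0)"
  have "lead_coeff (M t0 $$ (i0, j0)) \<noteq> 0" using nz(3) by simp
  then have ex: "\<exists>k. Q k" unfolding Q_def using nz(1,2) by blast
  \<comment> \<open>The lowest degree over all entries and all parameters, so that
    \<open>u^k\<close> divides \<open>M t\<close> for every \<open>t\<close>.\<close>
  define k where "k = (LEAST k. Q k)"
  have k: "Q k" unfolding k_def using ex by (rule LeastI_ex)
  have min: "\<not> Q l" if "l < k" for l using that unfolding k_def by (rule not_less_Least)
  \<comment> \<open>By the grading, degree \<open>k\<close> occurs in row \<open>i\<close> only in
    column \<open>(i + k) mod n\<close>.\<close>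
  define m where "m = (\<lambda>i t. coeff (M t $$ (i, (i + k) mod n)) k)"
  obtain t1 i1 where i1: "i1 < n" "m i1 t1 \<noteq> 0"
    using k M(4) unfolding Q_def m_def by blast
  have shift: "m (Suc i mod n) t = m i (shift_params n t)" if "i < n" for i t
  proof -
    have "(Suc i mod n + k) mod n = Suc ((i + k) mod n) mod n"
      by (simp add: mod_Suc_eq mod_add_left_eq)
    then show ?thesis unfolding m_def using M(2)[of i "(i + k) mod n" t] that n by simp
  qed
  have all_nz: "\<exists>t. m i t \<noteq> 0" if i: "i < n" for i
  proof (rule ccontr)
    assume "\<not> ?thesis"
    then have 0: "\<And>t. m i t = 0" by blast
    \<comment> \<open>If row \<open>i\<close> vanished for all parameters, the cyclic shift would
      carry this to every row, including row \<open>i1\<close>.\<close>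
    have "m ((i + l) mod n) t = 0" for l t
    proof (induction l arbitrary: t)
      case 0
      then show ?case using i \<open>\<And>t. m i t = 0\<close> by simp
    next
      case (Suc l)
      then show ?case using shift[of "(i + l) mod n" t] n by (simp add: mod_Suc_eq)
    qed
    from this[of "n + i1 - i" t1] i i1 show False by simp
  qed
  have "\<exists>t. (\<Prod>i<n. m i t) \<noteq> 0"
    using all_nz M(3) n unfolding m_def by (intro line_poly_prod_nonzero) auto
  then obtain t where t: "\<And>i. i < n \<Longrightarrow> m i t \<noteq> 0" by auto
  define N where "N = map_mat (poly_shift k) (M t)"
  have Nc: "N \<in> carrier_mat n n" using M(1) by (simp add: N_def)
  have MN: "M t = monom 1 k \<cdot>\<^sub>m N"
  proof (rule eq_matI)
    fix i j assume "i < dim_row (monom 1 k \<cdot>\<^sub>m N)" "j < dim_col (monom 1 k \<cdot>\<^sub>m N)"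
    then have ij: "i < n" "j < n" using Nc by auto
    have "coeff (M t $$ (i, j)) l = coeff (monom 1 k * poly_shift k (M t $$ (i, j))) l" for l
      using min[of l] ij unfolding Q_def by (auto simp: coeff_monom_mult coeff_poly_shift)
    then show "M t $$ (i, j) = (monom 1 k \<cdot>\<^sub>m N) $$ (i, j)"
      using ij M(1)[of t] by (simp add: N_def poly_eq_iff)
  qed (use M(1)[of t] Nc in auto)
  \<comment> \<open>The explicit inverse of the monomial matrix obtained from \<open>N\<close> at
    \<open>u = 0\<close>; with it, no signed permutation has to be computed.\<close>
  define W where "W = mat n n (\<lambda>(j, i). if j = (i + k) mod n then 1 / m i t else 0)"
  have Wc: "W \<in> carrier_mat n n" by (simp add: W_def)
  interpret ev: comm_ring_hom "\<lambda>p :: 'a poly. poly p u" for u by unfold_locales auto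
  let ?N0 = "map_mat (\<lambda>p. poly p 0) N"
  have N0c: "?N0 \<in> carrier_mat n n" using Nc by simp
  have N0: "?N0 $$ (i, j) = (if j = (i + k) mod n then m i t else 0)" if "i < n" "j < n" for i j
    using that M(1)[of t] M(4)[of i j t k]
    by (auto simp: N_def poly_0_coeff_0 coeff_poly_shift m_def)
  have "?N0 * W = 1\<^sub>m n"
  proof (rule eq_matI)
    fix i j assume "i < dim_row (1\<^sub>m n :: 'a mat)" "j < dim_col (1\<^sub>m n :: 'a mat)"
    then have ij: "i < n" "j < n" by auto
    have inj: "(i + k) mod n = (j + k) mod n \<longleftrightarrow> i = j"
      using ij by (rule add_mod_eq_iff)
    have "(?N0 * W) $$ (i, j) = (\<Sum>l<n. ?N0 $$ (i, l) * W $$ (l, j))"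
      by (rule mult_mat_entry[OF N0c Wc ij])
    also have "\<dots> = (\<Sum>l<n. if l = (i + k) mod n then m i t * W $$ (l, j) else 0)"
      using ij by (intro sum.cong) (auto simp: N0 simp del: index_map_mat)
    also have "\<dots> = m i t * W $$ ((i + k) mod n, j)" using n by simp
    also have "\<dots> = 1\<^sub>m n $$ (i, j)" using ij n t inj by (auto simp: W_def)
    finally show "(?N0 * W) $$ (i, j) = 1\<^sub>m n $$ (i, j)" .
  qed (use N0c Wc in auto)
  then have "det ?N0 * det W = 1" using det_mult[OF N0c Wc] by simp
  then have "poly (det N) 0 \<noteq> 0" by (auto simp: ev.hom_det)
  then have "det N \<noteq> 0" by auto
  then have "det (M t) \<noteq> 0" unfolding MN by simp
  then obtain u where "poly (det (M t)) u \<noteq> 0" using poly_all_0_iff_0 by blast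
  then have "det (map_mat (\<lambda>p. poly p u) (M t)) \<noteq> 0" by (simp add: ev.hom_det)
  then show ?thesis by blast
qed

section \<open>Commutators in matrix algebras\<close>

lemma lie_mat:
  assumes "x \<in> carrier_mat n n" "y \<in> carrier_mat n n"
  shows "ring.lie (mat_algebra scale n) x y = x * y - y * x"
proof -
  interpret ring "mat_algebra scale n" by (rule ring_mat_algebra)
  show ?thesis
    unfolding lie_def using assms by (simp add: mat_algebra_minus)
qed

lemma twisted_lie:
  assumes "twisted n M" "twisted n N"
  shows "twisted n (\<lambda>t. ring.lie (mat_algebra Polynomial.smult n) (M t) (N t))"
proof -
  have "ring.lie (mat_algebra Polynomial.smult n) (M t) (N t) =
      M t * N t + map_mat (Polynomial.smult (- 1)) (N t * M t)" for t
    unfolding lie_mat[OF twistedD(1)[OF assms(1)] twistedD(1)[OF assms(2)]]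
    using twistedD(1)[OF assms(1), of t] twistedD(1)[OF assms(2), of t] by (intro eq_matI) auto
  then show ?thesis
    using assms by (simp add: twisted_add twisted_smult twisted_mult)
qed

section \<open>Double brackets over the field\<close>

text \<open>Tested on matrix units \<open>E\<close>: the \<open>(r, s)\<close> entry of
  \<open>[[E, B], B] = E B^2 - 2 B E B + B^2 E\<close>, with \<open>E\<close> supported at
  \<open>(p, q)\<close>, gives the equations \<open>main\<close>.\<close>

lemma double_lie_zero_imp_central:
  fixes B :: "'f::field_char_0 mat"
  assumes B: "B \<in> carrier_mat n n"
    and zero: "\<And>y. y \<in> carrier_mat n n \<Longrightarrow>
      ring.lie (mat_algebra (*) n) (ring.lie (mat_algebra (*) n) y B) B = 0\<^sub>m n n"
  shows "B \<in> ring_center (mat_algebra (*) n)"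
proof -
  have BBc: "B * B \<in> carrier_mat n n" using B by simp
  have main: "(if r = p then (B * B) $$ (q, s) else 0) + (if s = q then (B * B) $$ (r, p) else 0)
      = 2 * B $$ (r, p) * B $$ (q, s)"
    if i: "p < n" "q < n" "r < n" "s < n" for p q r s
  proof -
    define e where "e = (\<lambda>(i, j). if i = p \<and> j = q then 1 else 0 :: 'f)"
    define E where "E = mat n n e"
    have E: "E \<in> carrier_mat n n" by (simp add: E_def)
    have EX: "(E * X) $$ (r, s) = (if r = p then X $$ (q, s) else 0)"
      if X: "X \<in> carrier_mat n n" and rs: "r < n" "s < n" for X r s
    proof -
      have "(E * X) $$ (r, s) = (\<Sum>l<n. if l = q then (if r = p then X $$ (q, s) else 0) else 0)"
        unfolding mult_mat_entry[OF E X rs] using rs by (intro sum.cong) (auto simp: E_def e_def)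
      then show ?thesis using i by simp
    qed
    have XE: "(X * E) $$ (r, s) = (if s = q then X $$ (r, p) else 0)"
      if X: "X \<in> carrier_mat n n" and rs: "r < n" "s < n" for X r s
    proof -
      have "(X * E) $$ (r, s) = (\<Sum>l<n. if l = p then (if s = q then X $$ (r, p) else 0) else 0)"
        unfolding mult_mat_entry[OF X E rs] using rs by (intro sum.cong) (auto simp: E_def e_def)
      then show ?thesis using i by simp
    qed
    have EBE: "(B * E * B) $$ (r, s) = B $$ (r, p) * B $$ (q, s)"
    proof -
      have "(B * E * B) $$ (r, s) = (\<Sum>l<n. if l = q then B $$ (r, p) * B $$ (q, s) else 0)"
        unfolding mult_mat_entry[OF mult_carrier_mat[OF B E] B i(3,4)]
        using i by (intro sum.cong) (auto simp: XE[OF B] simp del: index_mult_mat(1))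
      then show ?thesis using i by simp
    qed
    have C: "E * B - B * E \<in> carrier_mat n n" using B E by (simp add: minus_carrier_mat)
    have "(E * B - B * E) * B - B * (E * B - B * E) = 0\<^sub>m n n"
      using zero[OF E] unfolding lie_mat[OF E B] lie_mat[OF C B] .
    moreover have "(E * B - B * E) * B = E * (B * B) - B * E * B"
      using B E by (simp add: minus_mult_distrib_mat[of _ n n] assoc_mult_mat[of _ n n _ n _ n])
    moreover have "B * (E * B - B * E) = B * E * B - (B * B) * E"
      using B E by (simp add: mult_minus_distrib_mat[of B n n "E * B" n "B * E"] assoc_mult_mat[of _ n n _ n _ n])
    ultimately have "(E * (B * B) - B * E * B) - (B * E * B - (B * B) * E) = 0\<^sub>m n n" by simp
    then have "((E * (B * B) - B * E * B) - (B * E * B - (B * B) * E)) $$ (r, s) = 0"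
      using i by simp
    then have "((E * (B * B)) $$ (r, s) - (B * E * B) $$ (r, s)) -
        ((B * E * B) $$ (r, s) - ((B * B) * E) $$ (r, s)) = 0"
      using i B E by (simp del: index_mult_mat(1))
    then show ?thesis
      using i unfolding EX[OF BBc i(3,4)] XE[OF BBc i(3,4)] EBE by (simp add: algebra_simps)
  qed
  \<comment> \<open>For this choice both terms on the left of \<open>main\<close> vanish, leaving
    twice the square of the entry.\<close>
  have off: "B $$ (i, j) = 0" if "i < n" "j < n" "i \<noteq> j" for i j
    using main[of j i i j] that by simp
  have diag: "(B * B) $$ (i, i) = B $$ (i, i) * B $$ (i, i)" if "i < n" for i
  proof -
    have "(B * B) $$ (i, i) = (\<Sum>l<n. if l = i then B $$ (i, i) * B $$ (i, i) else 0)"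
      unfolding mult_mat_entry[OF B B that that] using that by (intro sum.cong) (auto simp: off)
    then show ?thesis using that by simp
  qed
  \<comment> \<open>Once \<open>B\<close> is diagonal, \<open>main\<close> with
    \<open>p = r = i\<close> and \<open>q = s = j\<close> says that the difference of the two
    diagonal entries squares to zero.\<close>
  have eq: "B $$ (i, i) = B $$ (j, j)" if "i < n" "j < n" for i j
  proof -
    have "(B $$ (i, i) - B $$ (j, j)) * (B $$ (i, i) - B $$ (j, j)) = 0"
      using main[of i j i j] that diag by (simp add: algebra_simps)
    then show ?thesis by simp
  qed
  have "B = scalar_matrix n (B $$ (0, 0))"
  proof (rule eq_matI)
    fix i j assume "i < dim_row (scalar_matrix n (B $$ (0, 0)))" "j < dim_col (scalar_matrix n (B $$ (0, 0)))"
    then have ij: "i < n" "j < n" by (auto simp: scalar_matrix_def)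
    then show "B $$ (i, j) = scalar_matrix n (B $$ (0, 0)) $$ (i, j)"
      using off[of i j] eq[of i 0] by (auto simp: scalar_matrix_def)
  qed (use B in \<open>auto simp: scalar_matrix_def\<close>)
  then show ?thesis using scalar_matrix_center by metis
qed

text \<open>A noncentral value of \<open>f\<close> has a nonzero double bracket with some
  \<open>y\<close>. So the double bracket of twisted generic matrices is not identically zero;
  \<open>twisted_det_nonzero\<close> then makes some specialization of it invertible.\<close>

lemma exists_invertible_double_lie:
  fixes f :: "'f::field_char_0 ncpoly" and n :: nat
  defines "R \<equiv> mat_algebra ((*) :: 'f \<Rightarrow> 'f \<Rightarrow> 'f) n"
  assumes "\<not> nc_identity R f" "\<not> nc_central R f"
  shows "\<exists>a y U. (\<forall>i. a i \<in> carrier_mat n n) \<and> y \<in> carrier_mat n n \<and> U \<in> carrier_mat n n \<and>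
    U * ring.lie R (ring.lie R y (nc_eval R a f)) (nc_eval R a f) = 1\<^sub>m n"
proof -
  have R: "ring R" unfolding R_def by (rule ring_mat_algebra)
  interpret R: ring R by (rule R)
  have Rc: "carrier R = carrier_mat n n" by (simp add: R_def)
  have eval_closed: "nc_eval R a f \<in> carrier R" if "\<And>i. a i \<in> carrier R" for a
    by (rule nc_eval_closed[OF R]) (use that in \<open>auto simp: R_def\<close>)
  have "\<not> nc_image R f \<subseteq> ring_center R" using assms by (simp add: nc_central_def)
  then obtain a where a: "\<And>i. a i \<in> carrier R" "nc_eval R a f \<notin> ring_center R"
    by (auto simp: nc_image_def)
  define W where "W = (\<lambda>y B. R.lie (R.lie y B) B)"
  obtain y where y: "y \<in> carrier R" "W y (nc_eval R a f) \<noteq> 0\<^sub>m n n"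
    using double_lie_zero_imp_central[of "nc_eval R a f" n] a eval_closed[OF a(1)]
    unfolding W_def R_def by auto
  define P where "P = mat_algebra (Polynomial.smult :: 'f \<Rightarrow> _) n"
  have P: "ring P" unfolding P_def by (rule ring_mat_algebra)
  interpret P: ring P by (rule P)
  define X :: "nat \<Rightarrow> (nat \<times> nat \<times> nat \<Rightarrow> 'f) \<Rightarrow> 'f poly mat" where "X = twisted_generic n"
  \<comment> \<open>Generic matrix 0 is reserved for \<open>y\<close>, so the letters of
    \<open>f\<close> are moved up by one.\<close>
  define Bt where "Bt = (\<lambda>t. nc_eval P (\<lambda>i. X (Suc i) t) f)"
  define M where "M = (\<lambda>t. P.lie (P.lie (X 0 t) (Bt t)) (Bt t))"
  have X: "twisted n (X v)" for v unfolding X_def by (rule twisted_generic)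
  have Bt: "twisted n Bt"
    unfolding Bt_def
    by (rule nc_eval_family[where P = "twisted n", OF P])
      (auto simp: P_def X twistedD(1) intro: twisted_zero twisted_one twisted_add twisted_mult twisted_smult)
  have M: "twisted n M" unfolding M_def P_def by (intro twisted_lie X Bt)
  let ?ev = "\<lambda>u. map_mat (\<lambda>p :: 'f poly. poly p u)"
  have hom: "?ev u \<in> ring_hom P R" for u
    unfolding P_def R_def by (rule map_mat_ring_hom) auto
  have Pc: "X v t \<in> carrier P" "Bt t \<in> carrier P" for v t
    using twistedD(1)[OF X] twistedD(1)[OF Bt] by (simp_all add: P_def)
  have evB: "?ev u (Bt t) = nc_eval R (\<lambda>i. ?ev u (X (Suc i) t)) f" for u t
    unfolding Bt_def
    by (rule nc_eval_hom[OF P R hom]) (use Pc in \<open>auto simp: P_def R_def intro!: eq_matI\<close>)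
  have evM: "?ev u (M t) = W (?ev u (X 0 t)) (nc_eval R (\<lambda>i. ?ev u (X (Suc i) t)) f)" for u t
    unfolding M_def W_def evB[symmetric] using Pc by (simp add: lie_hom[OF P R hom])
  define t0 where "t0 = (\<lambda>(v, i, j). (case v of 0 \<Rightarrow> y | Suc v \<Rightarrow> a v) $$ (i, j))"
  \<comment> \<open>At \<open>u = 1\<close> the twist disappears and every matrix over the field is
    a specialization.\<close>
  have ev1: "?ev 1 (X v t0) = (case v of 0 \<Rightarrow> y | Suc v \<Rightarrow> a v)" for v
    using y(1) a(1)[unfolded Rc, THEN carrier_matD(1)] a(1)[unfolded Rc, THEN carrier_matD(2)]
    unfolding Rc by (intro eq_matI) (auto simp: X_def twisted_generic_def t0_def poly_monom split: nat.split)
  have "?ev 1 (M t0) \<noteq> 0\<^sub>m n n" unfolding evM ev1 using y by simp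
  moreover have Mc: "M t \<in> carrier_mat n n" for t by (rule twistedD(1)[OF M])
  ultimately obtain i j where "i < n" "j < n" "M t0 $$ (i, j) \<noteq> 0"
    using Mc[of t0] by (metis (no_types, lifting) eq_matI[of "?ev 1 (M t0)" "0\<^sub>m n n"] carrier_matD index_map_mat
        index_zero_mat poly_0)
  from twisted_det_nonzero[OF M this] obtain t u where det: "det (?ev u (M t)) \<noteq> 0" by blast
  have "?ev u (M t) \<in> carrier_mat n n" using Mc by simp
  from det_non_zero_imp_unit[OF this det, of undefined]
  obtain U where U: "U \<in> carrier_mat n n" "U * ?ev u (M t) = 1\<^sub>m n"
    by (auto simp: Units_def ring_mat_def)
  have "?ev u (X v t) \<in> carrier_mat n n" for v using Pc by (simp add: P_def)
  with U[unfolded evM W_def] show ?thesis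
    by - (rule exI[of _ "\<lambda>i. ?ev u (X (Suc i) t)"], rule exI[of _ "?ev u (X 0 t)"],
        rule exI[of _ U], simp)
qed

section \<open>Passage to matrices over \<open>C\<close>\<close>

lemma (in comm_unital_algebra) map_mat_scale_mult:
  assumes "A \<in> carrier_mat n n" "B \<in> carrier_mat n n"
  shows "map_mat (scale r) (A * B) = map_mat (scale r) A * B"
    and "map_mat (scale r) (A * B) = A * map_mat (scale r) B"
proof -
  have right: "scale r (x * y) = x * scale r y" for x y
    using scale_mult_left[of r y x] by (simp add: mult.commute)
  show "map_mat (scale r) (A * B) = map_mat (scale r) A * B"
    using assms by (intro eq_matI) (auto simp: mult_mat_entry[of _ n] scale_sum_right scale_mult_left
        simp del: index_mult_mat(1))
  show "map_mat (scale r) (A * B) = A * map_mat (scale r) B"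
    using assms by (intro eq_matI) (auto simp: mult_mat_entry[of _ n] scale_sum_right right
        simp del: index_mult_mat(1))
qed

text \<open>Conjugation is an algebra automorphism, so it can be moved from the value of
  \<open>f\<close> to the arguments.\<close>

lemma conjugates_subset_nc_image:
  assumes alg: "comm_unital_algebra scale" and a: "\<And>i. a i \<in> carrier_mat n n"
  shows "ring.conjugates (mat_algebra scale n) (nc_eval (mat_algebra scale n) a f)
    \<subseteq> nc_image (mat_algebra scale n) f"
proof -
  interpret A: comm_unital_algebra scale by (rule alg)
  let ?R = "mat_algebra scale n"
  have R: "ring ?R" by (rule ring_mat_algebra)
  interpret ring ?R by (rule R)
  show ?thesis
  proof
    fix x assume "x \<in> conjugates (nc_eval ?R a f)"
    then obtain g h where gh: "g \<in> carrier_mat n n" "h \<in> carrier_mat n n"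
        "g * h = 1\<^sub>m n" "h * g = 1\<^sub>m n" and x: "x = g * nc_eval ?R a f * h"
      unfolding conjugates_def by auto
    let ?\<phi> = "\<lambda>z. g * z * h"
    have one: "1\<^sub>m n * z = z" if "z \<in> carrier_mat n n" for z :: "'b mat"
      using l_one[of z] that by simp
    have hom: "?\<phi> \<in> ring_hom ?R ?R"
    proof (rule ring_hom_memI)
      fix x y assume "x \<in> carrier ?R" "y \<in> carrier ?R"
      then have xy: "x \<in> carrier_mat n n" "y \<in> carrier_mat n n" by auto
      show "?\<phi> x \<in> carrier ?R"
        using mult_carrier_mat[OF mult_carrier_mat[OF gh(1) xy(1)] gh(2)] by simp
      have "?\<phi> x * ?\<phi> y = g * x * (h * g) * y * h"
        using gh(1,2) xy by (simp add: assoc_mult_mat[of _ n n _ n _ n])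
      also have "\<dots> = ?\<phi> (x * y)"
        unfolding gh(4) using gh(1,2) xy by (simp add: assoc_mult_mat[of _ n n _ n _ n] one)
      finally show "?\<phi> (x \<otimes>\<^bsub>?R\<^esub> y) = ?\<phi> x \<otimes>\<^bsub>?R\<^esub> ?\<phi> y" by simp
      show "?\<phi> (x \<oplus>\<^bsub>?R\<^esub> y) = ?\<phi> x \<oplus>\<^bsub>?R\<^esub> ?\<phi> y"
        using gh(1,2) xy by (simp add: mult_add_distrib_mat[of _ n n] add_mult_distrib_mat[of _ n n])
    next
      show "?\<phi> \<one>\<^bsub>?R\<^esub> = \<one>\<^bsub>?R\<^esub>" using gh r_one[of g] by simp
    qed
    have "x = nc_eval ?R (\<lambda>i. ?\<phi> (a i)) f"
      unfolding x
    proof (rule nc_eval_hom[OF R R hom])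
      fix r z assume "z \<in> carrier ?R"
      then have z: "z \<in> carrier_mat n n" by simp
      show "?\<phi> (r \<odot>\<^bsub>?R\<^esub> z) = r \<odot>\<^bsub>?R\<^esub> ?\<phi> z"
        using A.map_mat_scale_mult(2)[OF gh(1) z] A.map_mat_scale_mult(1)[of "g * z" n h] gh z by simp
    qed (use a in auto)
    moreover have "(\<lambda>i. ?\<phi> (a i)) \<in> UNIV \<rightarrow> carrier ?R" using mult_carrier_mat[OF mult_carrier_mat[OF gh(1) a] gh(2)] by auto
    ultimately show "x \<in> nc_image ?R f" unfolding nc_image_def by blast
  qed
qed

text \<open>The matrices with invertible double bracket are found over \<open>F\<close> and mapped
  entrywise into \<open>A\<close>. There \<open>lie_in_nsums\<close> applies with
  \<open>k = 10\<close>, and differences of conjugates of \<open>b\<close> are differences of values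
  of \<open>f\<close>.\<close>

theorem corollary3p13:
  fixes n :: nat
    and f :: "'f::field_char_0 ncpoly"
    and scale :: "'f \<Rightarrow> 'c::{comm_ring,monoid_mult} \<Rightarrow> 'c"
  assumes "n > 0"
    and "\<not> nc_identity (mat_algebra ((*) :: 'f \<Rightarrow> 'f \<Rightarrow> 'f) n) f"
    and "\<not> nc_central (mat_algebra ((*) :: 'f \<Rightarrow> 'f \<Rightarrow> 'f) n) f"
    and "comm_unital_algebra scale"
  shows "\<forall>c\<in>commutators (mat_algebra scale n).
    \<exists>t :: nat \<Rightarrow> 'c mat.
      (\<forall>i<7788. t i \<in> nc_image_diff (mat_algebra scale n) f) \<and>
      c = (\<Oplus>\<^bsub>mat_algebra scale n\<^esub>i\<in>{..<7788}. t i)"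
proof
  interpret A: comm_unital_algebra scale by fact
  define R where "R = mat_algebra ((*) :: 'f \<Rightarrow> 'f \<Rightarrow> 'f) n"
  let ?A = "mat_algebra scale n"
  have ringR: "ring R" unfolding R_def by (rule ring_mat_algebra)
  have ringA: "ring ?A" by (rule ring_mat_algebra)
  interpret R: ring R by (rule ringR)
  obtain a y U where a: "\<And>i. a i \<in> carrier_mat n n" and yU: "y \<in> carrier_mat n n" "U \<in> carrier_mat n n"
    and inv: "U * R.lie (R.lie y (nc_eval R a f)) (nc_eval R a f) = 1\<^sub>m n"
    using exists_invertible_double_lie[OF assms(2,3)] unfolding R_def by blast
  \<comment> \<open>The structure map from \<open>F\<close> to \<open>C\<close>. It preserves the
    equation \<open>U [[y, f(a)], f(a)] = 1\<close>, so invertibility carries over to every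
    \<open>C\<close>.\<close>
  define \<theta> where "\<theta> = (\<lambda>r. scale r 1)"
  have \<theta>_mult: "\<theta> (r * s) = scale r (\<theta> s)" for r s by (simp add: \<theta>_def)
  have \<theta>_scale: "scale r x = \<theta> r * x" for r x
    unfolding \<theta>_def using A.scale_mult_left[of r 1 x] by simp
  have hom: "map_mat \<theta> \<in> ring_hom R ?A"
    unfolding R_def
  proof (rule map_mat_ring_hom)
    show "\<theta> (r + s) = \<theta> r + \<theta> s" for r s by (simp add: \<theta>_def A.scale_left_distrib)
    show "\<theta> (r * s) = \<theta> r * \<theta> s" for r s by (simp add: \<theta>_mult \<theta>_scale)
    show "\<theta> 1 = 1" by (simp add: \<theta>_def)
  qed
  define b where "b = map_mat \<theta> (nc_eval R a f)"
  have b_eval: "b = nc_eval ?A (\<lambda>i. map_mat \<theta> (a i)) f"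
    unfolding b_def
    by (rule nc_eval_hom[OF ringR ringA hom])
      (use a in \<open>auto simp: R_def \<theta>_mult intro!: eq_matI\<close>)
  have evalR: "nc_eval R a f \<in> carrier R"
    by (rule nc_eval_closed[OF ringR]) (use a in \<open>auto simp: R_def\<close>)
  define h where "h = scalar_matrix n (\<theta> (1 / 2))"
  interpret spanned_by_square_zero ?A b h 10
  proof (unfold spanned_by_square_zero_def spanned_by_square_zero_axioms_def, intro conjI allI impI ringA)
    show "b \<in> carrier ?A" using evalR by (simp add: b_def R_def)
    show "h \<in> ring_center ?A" unfolding h_def by (rule scalar_matrix_center)
    have "\<theta> (1 / 2) + \<theta> (1 / 2) = scale (1 / 2 + 1 / 2) 1"
      unfolding \<theta>_def by (rule A.scale_left_distrib[symmetric])
    then have "\<theta> (1 / 2) + \<theta> (1 / 2) = 1" by simp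
    then show "h \<oplus>\<^bsub>?A\<^esub> h = \<one>\<^bsub>?A\<^esub>" by (auto simp: h_def scalar_matrix_def intro!: eq_matI)
    show "\<exists>c q. c \<in> ring_center ?A \<and> q \<in> nsums ?A (ring.square_zero ?A) 10 \<and> x = c \<oplus>\<^bsub>?A\<^esub> q"
      if "x \<in> carrier ?A" for x
      using central_plus_sq_sums[OF assms(1,4)] that by simp
  qed
  have diffs: "S \<subseteq> nc_image_diff ?A f"
    using conjugates_subset_nc_image[OF assms(4), of "\<lambda>i. map_mat \<theta> (a i)" n f] a
    unfolding conjugate_diffs_def nc_image_diff_def b_eval by auto
  have yc: "y \<in> carrier R" using yU by (simp add: R_def)
  have "map_mat \<theta> U \<otimes>\<^bsub>?A\<^esub> lie (lie (map_mat \<theta> y) b) b =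
      map_mat \<theta> (U * R.lie (R.lie y (nc_eval R a f)) (nc_eval R a f))"
    using ring_hom_mult[OF hom, of U "R.lie (R.lie y (nc_eval R a f)) (nc_eval R a f)"] yU yc evalR
    by (simp add: b_def lie_hom[OF ringR ringA hom]) (simp add: R_def)
  also have "\<dots> = \<one>\<^bsub>?A\<^esub>" unfolding inv using ring_hom_one[OF hom] by (simp add: R_def)
  finally have inv': "map_mat \<theta> U \<otimes>\<^bsub>?A\<^esub> lie (lie (map_mat \<theta> y) b) b = \<one>\<^bsub>?A\<^esub>" .
  fix c assume "c \<in> commutators ?A"
  then obtain z w where zw: "z \<in> carrier ?A" "w \<in> carrier ?A" "c = lie z w"
    unfolding commutators_def lie_def by blast
  have "c \<in> nsums ?A S (6 * 10\<^sup>2)"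
    unfolding zw(3) by (rule lie_in_nsums[OF _ _ inv' zw(1,2)]) (use yU in auto)
  \<comment> \<open>The count so far is \<open>6 * 10^2 = 600\<close>; the remaining summands are
    zero, which is the difference \<open>b - b\<close>.\<close>
  then have "c \<in> nsums ?A S 7788"
    using nsums_mono[OF conjugate_diffs_closed[OF b] zero_conjugate_diffs[OF b], of "6 * 10\<^sup>2" 7788] by auto
  from nsums_finsum[OF conjugate_diffs_closed[OF b] this] diffs
  show "\<exists>t :: nat \<Rightarrow> 'c mat. (\<forall>i<7788. t i \<in> nc_image_diff ?A f) \<and> c = (\<Oplus>\<^bsub>?A\<^esub>i\<in>{..<7788}. t i)"
    by blast
qed

end
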